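(* For every integer $h\ge3$ there exists an infinite $B_h$ sequence $A$ of positive integers (i.e. all sums $a_1+\cdots+a_h$ with $a_1\le\cdots\le a_h$, $a_i\in A$, are distinct) whose counting function satisfies $A(x)=\#\{a\in A: a\le x\}=x^{\sqrt{(h-1)^2+1}-(h-1)+o(1)}$ as $x\to\infty$. *)

theory Defs
  imports Complex_Main "HOL-Library.Landau_Symbols"
begin

text \<open>A sum of \<open>h\<close> terms \<open>a\<^sub>1 \<le> \<dots> \<le> a\<^sub>h\<close>, repetitions allowed, is represented by the sorted list
  of its terms.\<close>

definition B_seq :: "nat \<Rightarrow> nat set \<Rightarrow> bool" where
  "B_seq h A \<longleftrightarrow>
     0 \<notin> A \<and> inj_on sum_list {xs. length xs = h \<and> sorted xs \<and> set xs \<subseteq> A}"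

definition counting :: "nat set \<Rightarrow> real \<Rightarrow> nat" where
  "counting A x = card {a \<in> A. real a \<le> x}"

end

theory Submission
  imports Defs "HOL-Number_Theory.Number_Theory" "HOL-Real_Asymp.Real_Asymp" "HOL-Library.FuncSet"
begin

text \<open>
  The construction is Cilleruelo's. Fix primes \<open>q\<^sub>0 < q\<^sub>1 < \<dots>\<close>, where \<open>q\<^sub>j\<close> has about \<open>3j\<^sup>2\<close> bits. A
  prime \<open>p\<close> of level \<open>k\<close>, i.e. of about \<open>c k\<^sup>3\<close> bits, is coded by the number whose \<open>k\<close> digits in a mixed
  radix system are the discrete logarithms of \<open>p\<close> modulo \<open>q\<^sub>0, \<dots>, q\<^bsub>k-1\<^esub>\<close>; the code has about \<open>k\<^sup>3\<close>
  bits, whence the exponent \<open>c\<close>. Digits are added without carries, so a coincidence between two sums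
  of at most \<open>h\<close> codes gives, for every \<open>j\<close>, a congruence modulo \<open>q\<^sub>j\<close> between the products of the
  primes of level above \<open>j\<close> on either side. After cancellation these products differ, so a random
  choice of the \<open>q\<^sub>j\<close> satisfies all the congruences with probability at most \<open>2\<close> to the power
  \<open>- k\<^sup>3 + o(k\<^sup>3)\<close>, where \<open>k\<close> is the top level. For \<open>c\<^sup>2 + 2 (h - 1) c = 1\<close> the expected number of
  coincidences of top level \<open>k\<close> is then much smaller than the number of primes of level \<open>k\<close>, and
  deleting one prime for each coincidence keeps at least half of every level.
\<close>

section \<open>Many primes\<close>

text \<open>Induction on \<open>k\<close> along Leibniz's harmonic triangle: the reciprocal of
  \<open>Suc k * (n choose Suc k)\<close> is the difference of the reciprocals of
  \<open>k * (n - 1 choose k)\<close> and \<open>k * (n choose k)\<close>. The cofactor in the next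
  case is therefore the difference \<open>a - b\<close> of two earlier cofactors.\<close>

lemma mult_binomial_dvd_common_multiple:
  fixes D :: nat
  assumes "1 \<le> k" "k \<le> n" "\<And>i. i \<in> {1..n} \<Longrightarrow> i dvd D"
  shows "k * (n choose k) dvd D"
  using assms
proof (induction k arbitrary: n rule: nat_induct_at_least)
  case base
  then show ?case by auto
next
  case (Suc k)
  obtain n' where n: "n = Suc n'"
    using Suc.prems(1) by (cases n) auto
  from Suc have kn: "k \<le> n'" "1 \<le> k" by (auto simp: n)
  have "k * (n' choose k) dvd D" "k * (n choose k) dvd D"
    using Suc.IH[of n'] Suc.IH[of n] Suc.prems kn by (auto simp: n)
  then obtain a b where a: "D = k * (n' choose k) * a" and b: "D = k * (n choose k) * b"
    by (metis dvdE)
  have pos: "n' choose k > 0" "n choose k > 0" "n choose Suc k > 0"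
    using kn by (auto simp: n)
  have e1: "Suc k * (n choose Suc k) = n * (n' choose k)"
    using Suc_times_binomial_eq[of n' k] by (simp only: n mult.commute)
  have e2: "(n - k) * (n choose k) = n * (n' choose k)"
    using binomial_absorb_comp[of n k] by (simp add: n)
  have "real D = (real a - real b) * real (Suc k * (n choose Suc k))"
  proof -
    define X where "X = real (n' choose k)"
    define Y where "Y = real (n choose k)"
    have XY: "X > 0" "Y > 0" using pos by (auto simp: X_def Y_def)
    have E2: "(real n - real k) * Y = real n * X"
      using arg_cong[OF e2, of real] kn n unfolding X_def Y_def of_nat_mult by (subst (asm) of_nat_diff) auto
    have E3: "k * Y * b = k * X * a"
      using arg_cong[OF a, of real] arg_cong[OF b, of real] by (simp add: X_def Y_def)
    then have E4: "Y * b = X * a" using kn by simp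
    have "(real a - real b) * (real n * X) = real n * (X * a) - b * (real n * X)"
      by (simp add: algebra_simps)
    also have "\<dots> = real n * (Y * b) - b * ((real n - real k) * Y)"
      by (simp only: E4 E2)
    also have "\<dots> = k * Y * b" by (simp add: algebra_simps)
    also have "\<dots> = D" using b by (simp add: Y_def)
    finally show ?thesis unfolding e1 by (simp add: X_def)
  qed
  then have "of_int (int D) = (of_int ((int a - int b) * int (Suc k * (n choose Suc k))) :: real)"
    by simp
  then have "int D = (int a - int b) * int (Suc k * (n choose Suc k))"
    by (simp only: of_int_eq_iff)
  then show ?case
    by (metis dvd_triv_right int_dvd_int_iff)
qed

lemma ex_common_multiple_le_power_card_primes:
  fixes n :: nat
  assumes "n \<ge> 1"
  obtains D where "D > 0" "\<And>i. i \<in> {1..n} \<Longrightarrow> i dvd D" "D \<le> n ^ card {p. prime p \<and> p \<le> n}"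
proof -
  define P where "P = {p::nat. prime p \<and> p \<le> n}"
  \<comment> \<open>The largest exponent of \<open>p\<close> in any of the numbers up to
    \<open>n\<close>. Thus \<open>D\<close> is their least common multiple, and each
    \<open>p ^ e p\<close> divides one of them, so it is at most \<open>n\<close>.\<close>
  define e where "e = (\<lambda>p::nat. Max ((\<lambda>i. multiplicity p i) ` {1..n}))"
  define D where "D = (\<Prod>p\<in>P. p ^ e p)"
  have finP: "finite P" by (rule finite_subset[of _ "{..n}"]) (auto simp: P_def)
  have "i dvd D" if i: "i \<in> {1..n}" for i
  proof -
    have "i = (\<Prod>p\<in>prime_factors i. p ^ multiplicity p i)"
      using i by (intro prime_factorization_nat) auto
    also have "\<dots> dvd D"
      unfolding D_def
    proof (rule prod_dvd_prod_subset2[OF finP])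
      show "prime_factors i \<subseteq> P"
      proof
        fix p assume "p \<in> prime_factors i"
        then have "prime p" "p dvd i" by (auto simp: in_prime_factors_iff)
        moreover from \<open>p dvd i\<close> have "p \<le> i" using i by (intro dvd_imp_le) auto
        ultimately show "p \<in> P" using i by (simp add: P_def)
      qed
      show "a ^ multiplicity a i dvd a ^ e a" for a
        unfolding e_def using i by (intro le_imp_power_dvd Max_ge) auto
    qed
    finally show ?thesis .
  qed
  moreover have "D \<le> n ^ card P"
  proof -
    have "p ^ e p \<le> n" for p
    proof -
      have "e p \<in> (\<lambda>i. multiplicity p i) ` {1..n}"
        unfolding e_def using assms by (intro Max_in) auto
      then obtain i where i: "i \<in> {1..n}" "e p = multiplicity p i" by auto
      have "p ^ e p dvd i" unfolding i(2) by (rule multiplicity_dvd)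
      then show ?thesis using i(1) by (auto dest: dvd_imp_le)
    qed
    then have "D \<le> (\<Prod>p\<in>P. n)"
      unfolding D_def by (intro prod_mono) auto
    then show ?thesis by simp
  qed
  moreover have "D > 0"
    unfolding D_def P_def by (intro prod_pos) (auto simp: prime_gt_0_nat)
  ultimately show thesis using that by (auto simp: P_def)
qed

text \<open>Nair's proof of a Chebyshev bound. With \<open>2 * n = 2 ^ M\<close>, the number
  \<open>n * (2 * n choose n)\<close> divides the common multiple and is at least half of
  \<open>4 ^ n\<close>; comparing exponents of two gives the claim.\<close>

lemma card_primes_le_power_two:
  assumes "M \<ge> 1"
  shows "2 ^ M \<le> M * card {p::nat. prime p \<and> p \<le> 2 ^ M} + 1"
proof -
  define n :: nat where "n = 2 ^ (M - 1)"
  have n2: "2 * n = 2 ^ M" using assms by (cases M) (auto simp: n_def)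
  have n: "n \<ge> 1" by (simp add: n_def)
  obtain D where D: "D > 0" "\<And>i. i \<in> {1..2 * n} \<Longrightarrow> i dvd D"
    "D \<le> (2 * n) ^ card {p. prime p \<and> p \<le> 2 * n}"
    using ex_common_multiple_le_power_card_primes[of "2 * n"] n by auto
  have "n * (2 * n choose n) dvd D"
    using n D(2) by (intro mult_binomial_dvd_common_multiple) auto
  then have "n * (2 * n choose n) \<le> D" using D(1) by (rule dvd_imp_le)
  moreover have "4 ^ n \<le> 2 * (n * (2 * n choose n))"
  proof -
    have "4 ^ n \<le> 2 * (real n * real (2 * n choose n))"
      using central_binomial_lower_bound[of n] n by (simp add: field_simps)
    then have "real (4 ^ n) \<le> real (2 * (n * (2 * n choose n)))" by simp
    then show ?thesis by (simp only: of_nat_le_iff)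
  qed
  ultimately have "4 ^ n \<le> 2 * (2 * n) ^ card {p. prime p \<and> p \<le> 2 * n}"
    using D(3) by linarith
  moreover have "(4::nat) ^ n = 2 ^ 2 ^ M"
    by (simp add: n2[symmetric] power_mult)
  ultimately have "(2::nat) ^ 2 ^ M \<le> 2 ^ (M * card {p. prime p \<and> p \<le> (2::nat) ^ M} + 1)"
    by (simp add: n2 power_mult)
  then show ?thesis
    by (rule power_le_imp_le_exp[rotated]) simp
qed

section \<open>Prime divisors of a number of bounded size\<close>

lemma prod_primes_dvd:
  fixes N :: nat
  assumes "finite A" "\<And>p. p \<in> A \<Longrightarrow> prime p" "\<And>p. p \<in> A \<Longrightarrow> p dvd N"
  shows "\<Prod>A dvd N"
  using assms
proof (induction A)
  case (insert p A)
  have "coprime p (\<Prod>A)"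
    using insert by (intro prod_coprime_right) (auto intro!: primes_coprime)
  then show ?case using insert by (simp add: divides_mult)
qed simp

lemma card_primes_dvd_le:
  fixes N :: nat
  assumes "finite A" "\<And>p. p \<in> A \<Longrightarrow> prime p \<and> p dvd N" "N > 0" "N \<le> 2 ^ k"
  shows "card A \<le> k"
proof -
  have "2 ^ card A = (\<Prod>p\<in>A. 2::nat)" by simp
  also have "\<dots> \<le> \<Prod>A" using assms(2) by (intro prod_mono) (auto dest: prime_ge_2_nat)
  also have "\<dots> \<le> N" using assms prod_primes_dvd[of A N] by (intro dvd_imp_le) auto
  also have "\<dots> \<le> 2 ^ k" by fact
  finally show ?thesis by (rule power_le_imp_le_exp[rotated]) simp
qed

section \<open>Discrete logarithms and mixed radix digits\<close>

text \<open>The primitive root depends on \<open>q\<close> alone, so logarithms of different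
  \<open>p\<close> share a base and their sums correspond to products. If \<open>q\<close> divides
  \<open>p\<close>, the value is unspecified.\<close>

definition dlog :: "nat \<Rightarrow> nat \<Rightarrow> nat" where
  "dlog q p = (SOME x. x < q \<and> [(SOME g. residue_primroot q g) ^ x = p] (mod q))"

lemma dlog:
  assumes "prime q" "\<not> q dvd p"
  shows "dlog q p < q" "[(SOME g. residue_primroot q g) ^ dlog q p = p] (mod q)"
proof -
  define g where "g = (SOME g. residue_primroot q g)"
  have q: "q > 1" using assms(1) by (rule prime_gt_1_nat)
  have g: "residue_primroot q g"
    unfolding g_def using prime_primitive_root_exists[OF q assms(1)] by (rule someI_ex)
  have "p mod q \<in> totatives q"
  proof -
    have "coprime (p mod q) q"
      using prime_imp_coprime[OF assms] q by (simp add: coprime_commute)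
    moreover have "p mod q > 0" using assms(2) by (simp add: dvd_eq_mod_eq_0)
    moreover have "p mod q \<le> q" using q by (simp add: less_imp_le)
    ultimately show ?thesis by (simp add: totatives_def)
  qed
  then have "p mod q \<in> (\<lambda>i. g ^ i mod q) ` {..<totient q}"
    using residue_primroot_is_generator[OF q g] by (auto simp: bij_betw_def)
  then obtain x where x: "x < totient q" "p mod q = g ^ x mod q" by auto
  have "x < q" using x(1) totient_le[of q] by linarith
  then have "\<exists>x. x < q \<and> [g ^ x = p] (mod q)"
    using x(2) by (intro exI[of _ x]) (simp add: unique_euclidean_semiring_class.cong_def)
  then have "dlog q p < q \<and> [g ^ dlog q p = p] (mod q)"
    unfolding dlog_def g_def by (rule someI_ex)
  then show "dlog q p < q" "[(SOME g. residue_primroot q g) ^ dlog q p = p] (mod q)"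
    by (auto simp: g_def)
qed

lemma cong_power_sum_dlog:
  assumes "prime q" "\<And>p. p \<in># M \<Longrightarrow> \<not> q dvd p"
  shows "[(SOME g. residue_primroot q g) ^ (\<Sum>p\<in>#M. dlog q p) = prod_mset M] (mod q)"
  using assms(2)
proof (induction M)
  case (add p M)
  then show ?case
    using dlog(2)[OF assms(1), of p] by (auto simp: power_add intro: cong_mult)
qed simp

lemma cong_prod_mset_if_sum_dlog_eq:
  assumes "prime q" "\<And>p. p \<in># M + N \<Longrightarrow> \<not> q dvd p"
    and "(\<Sum>p\<in>#M. dlog q p) = (\<Sum>p\<in>#N. dlog q p)"
  shows "[prod_mset M = prod_mset N] (mod q)"
  using cong_power_sum_dlog[OF assms(1), of M] cong_power_sum_dlog[OF assms(1), of N] assms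
  by (metis cong_sym cong_trans union_iff)

lemma mixed_radix_less:
  fixes B :: "nat \<Rightarrow> nat"
  assumes "\<And>j. j < n \<Longrightarrow> u j < B j"
  shows "(\<Sum>j<n. u j * (\<Prod>i<j. B i)) < (\<Prod>i<n. B i)"
  using assms
proof (induction n)
  case (Suc n)
  have "(\<Sum>j<Suc n. u j * (\<Prod>i<j. B i)) < (\<Prod>i<n. B i) + u n * (\<Prod>i<n. B i)"
    using Suc by simp
  also have "\<dots> = Suc (u n) * (\<Prod>i<n. B i)" by simp
  also have "\<dots> \<le> B n * (\<Prod>i<n. B i)"
    using Suc.prems[of n] by (intro mult_le_mono1) auto
  finally show ?case by (simp add: mult.commute)
qed simp

text \<open>By \<open>mixed_radix_less\<close> the lower part is smaller than the weight of the top
  digit, so division by this weight recovers the top digit; the rest is induction.\<close>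

lemma mixed_radix_inj:
  fixes B :: "nat \<Rightarrow> nat"
  assumes "\<And>j. j < n \<Longrightarrow> u j < B j" "\<And>j. j < n \<Longrightarrow> v j < B j"
    and "(\<Sum>j<n. u j * (\<Prod>i<j. B i)) = (\<Sum>j<n. v j * (\<Prod>i<j. B i))" "j < n"
  shows "u j = v j"
  using assms
proof (induction n)
  case (Suc n)
  define W where "W = (\<Prod>i<n. B i)"
  define U where "U = (\<Sum>j<n. u j * (\<Prod>i<j. B i))"
  define V where "V = (\<Sum>j<n. v j * (\<Prod>i<j. B i))"
  have lt: "U < W" "V < W"
    unfolding U_def V_def W_def using Suc.prems by (intro mixed_radix_less; simp)+
  have eq: "U + u n * W = V + v n * W"
    using Suc.prems(3) by (simp add: U_def V_def W_def)
  have "(U + u n * W) div W = u n" "(V + v n * W) div W = v n"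
    using lt by auto
  then have top: "u n = v n" using eq by simp
  then have "U = V" using eq by simp
  then show ?case
    using Suc.IH Suc.prems top unfolding U_def V_def by (cases "j = n") auto
qed simp

section \<open>Choosing and counting\<close>

text \<open>Koenig's lemma: averaging handles only finitely many levels at once, and this yields one
  infinite sequence. \<open>Ext k q\<close> says that the first \<open>k\<close> entries of
  \<open>q\<close> extend to solutions of every finite length; such prefixes can be prolonged
  forever, and locality of \<open>Good\<close> carries the conditions to the limit.\<close>

lemma konig_choice:
  fixes S :: "nat \<Rightarrow> 'a set" and Good :: "nat \<Rightarrow> (nat \<Rightarrow> 'a) \<Rightarrow> bool"
  assumes fin: "\<And>j. finite (S j)"
    and local: "\<And>K q q'. (\<And>j. j < K \<Longrightarrow> q j = q' j) \<Longrightarrow> Good K q \<Longrightarrow> Good K q'"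
    and ex: "\<And>n. \<exists>q. (\<forall>j<n. q j \<in> S j) \<and> (\<forall>K\<le>n. Good K q)"
  shows "\<exists>q. \<forall>j. q j \<in> S j \<and> Good j q"
proof -
  define Ext where "Ext k q \<longleftrightarrow>
    (\<forall>n. \<exists>q'. (\<forall>i<k. q' i = q i) \<and> (\<forall>j<n. q' j \<in> S j) \<and> (\<forall>K\<le>n. Good K q'))" for k q
  have step: "\<exists>q'. Ext (Suc k) q' \<and> (\<forall>i<k. q' i = q i)" if "Ext k q" for k q
  proof (rule ccontr)
    assume "\<not> ?thesis"
    then have "\<not> Ext (Suc k) (q(k := s))" for s by auto
    then have "\<forall>s. \<exists>n. \<not> (\<exists>q'. (\<forall>i<Suc k. q' i = (q(k := s)) i) \<and> (\<forall>j<n. q' j \<in> S j)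
        \<and> (\<forall>K\<le>n. Good K q'))"
      unfolding Ext_def by blast
    then obtain n where n: "\<And>s. \<not> (\<exists>q'. (\<forall>i<Suc k. q' i = (q(k := s)) i)
        \<and> (\<forall>j<n s. q' j \<in> S j) \<and> (\<forall>K\<le>n s. Good K q'))"
      by metis
    \<comment> \<open>If every value \<open>s\<close> at place \<open>k\<close> fails from some
      length \<open>n s\<close> on, a solution of length \<open>m\<close> has an entry at
      \<open>k\<close> that should have failed already. Including \<open>Suc k\<close> ensures that
      this entry lies in \<open>S k\<close>.\<close>
    define m where "m = Max (insert (Suc k) (n ` S k))"
    obtain q' where q': "\<forall>i<k. q' i = q i" "\<forall>j<m. q' j \<in> S j" "\<forall>K\<le>m. Good K q'"
      using \<open>Ext k q\<close> unfolding Ext_def by blast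
    have "Suc k \<le> m" unfolding m_def using fin by (intro Max_ge) auto
    then have "q' k \<in> S k" using q'(2) by auto
    then have "n (q' k) \<le> m" unfolding m_def using fin by (intro Max_ge) auto
    then show False
      using n[of "q' k"] q' by (auto simp: less_Suc_eq)
  qed
  have "Ext 0 (\<lambda>_. undefined)"
    unfolding Ext_def using ex by auto
  then obtain f where f: "\<And>k. Ext k (f k)" "\<And>k. \<forall>i<k. f (Suc k) i = f k i"
    using dependent_nat_choice[where P = Ext and Q = "\<lambda>k q q'. \<forall>i<k. q' i = q i"] step by metis
  define q where "q = (\<lambda>i. f (Suc i) i)"
  have fq: "f k i = q i" if "i < k" for i k
    using that
  proof (induction k)
    case (Suc k)
    then show ?case using f(2)[of k] by (cases "i = k") (auto simp: q_def)
  qed simp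
  show ?thesis
  proof (intro exI allI)
    fix j
    obtain q' where q': "\<forall>i<Suc j. q' i = f (Suc j) i" "\<forall>i<Suc j. q' i \<in> S i"
        "\<forall>K\<le>Suc j. Good K q'"
      using f(1)[of "Suc j"] unfolding Ext_def by blast
    have "\<And>i. i \<le> j \<Longrightarrow> q' i = q i" using q'(1) fq[of _ "Suc j"] by auto
    then show "q j \<in> S j \<and> Good j q"
      using q'(2,3) local[of j q' q] by (metis le_eq_less_or_eq lessI less_SucI)
  qed
qed

text \<open>A union-free probability bound: the coordinates are chosen independently, and for each
  \<open>j < K\<close> at most \<open>D\<close> of the at least \<open>s j\<close> primes divide
  \<open>N j\<close>. The coordinates from \<open>K\<close> on are free.\<close>

lemma card_PiE_dvd_le:
  fixes S :: "nat \<Rightarrow> nat set" and b s :: "nat \<Rightarrow> nat"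
  assumes "K \<le> n" and fin: "\<And>j. finite (S j)" and prime: "\<And>j p. p \<in> S j \<Longrightarrow> prime p"
    and card: "\<And>j. s j \<le> card (S j)" "\<And>j. s j > 0"
    and N: "\<And>j. j < K \<Longrightarrow> 0 < N j \<and> N j \<le> (2::nat) ^ D"
  shows "real (card {q \<in> PiE {..<n} S. \<forall>j<K. q j dvd N j})
    \<le> real (card (PiE {..<n} S)) * (real D ^ K / (\<Prod>j<K. real (s j)))"
proof -
  define T where "T = (\<lambda>j. if j < K then {p \<in> S j. p dvd N j} else S j)"
  have "{q \<in> PiE {..<n} S. \<forall>j<K. q j dvd N j} \<subseteq> PiE {..<n} T"
    by (auto simp: T_def PiE_iff extensional_def)
  moreover have "finite (PiE {..<n} T)"
    using fin by (intro finite_PiE) (auto simp: T_def)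
  ultimately have "card {q \<in> PiE {..<n} S. \<forall>j<K. q j dvd N j} \<le> card (PiE {..<n} T)"
    by (rule card_mono[rotated])
  then have "real (card {q \<in> PiE {..<n} S. \<forall>j<K. q j dvd N j}) \<le> (\<Prod>j<n. real (card (T j)))"
    by (simp add: card_PiE flip: of_nat_prod)
  also have "\<dots> \<le> (\<Prod>j<n. real (card (S j)) * (if j < K then real D / real (s j) else 1))"
  proof (intro prod_mono conjI)
    fix j
    show "real (card (T j)) \<le> real (card (S j)) * (if j < K then real D / real (s j) else 1)"
    proof (cases "j < K")
      case True
      have "card (T j) \<le> D"
        using True N[OF True] fin[of j] prime[of _ j]
        by (intro card_primes_dvd_le[of _ "N j"]) (auto simp: T_def)
      then have "real (card (T j)) * real (s j) \<le> real D * real (card (S j))"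
        using card(1)[of j] by (intro mult_mono) auto
      then show ?thesis using True card(2)[of j] by (simp add: field_simps)
    qed (simp add: T_def)
  qed simp
  also have "\<dots> = (\<Prod>j<n. real (card (S j))) * (\<Prod>j<n. if j < K then real D / real (s j) else 1)"
    by (simp add: prod.distrib)
  also have "(\<Prod>j<n. if j < K then real D / real (s j) else 1) = (\<Prod>j<K. real D / real (s j))"
    using assms(1) by (intro prod.mono_neutral_cong_right) auto
  also have "\<dots> = real D ^ K / (\<Prod>j<K. real (s j))"
    by (simp add: prod_dividef)
  finally show ?thesis by (simp add: card_PiE flip: of_nat_prod)
qed

lemma card_map_eq_le:
  fixes f :: "'a \<Rightarrow> 'b" and B :: "'b \<Rightarrow> 'a set"
  assumes "\<And>k. finite (B k)"
  shows "finite {xs. map f xs = ks \<and> (\<forall>x\<in>set xs. x \<in> B (f x))}"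
    and "card {xs. map f xs = ks \<and> (\<forall>x\<in>set xs. x \<in> B (f x))} \<le> (\<Prod>k\<leftarrow>ks. card (B k))"
proof (induction ks)
  case Nil
  have *: "{xs. map f xs = [] \<and> (\<forall>x\<in>set xs. x \<in> B (f x))} = {[]}" by auto
  { case 1 show ?case unfolding * by simp }
  { case 2 show ?case unfolding * by simp }
next
  case (Cons k ks)
  let ?L = "\<lambda>ks. {xs. map f xs = ks \<and> (\<forall>x\<in>set xs. x \<in> B (f x))}"
  have sub: "?L (k # ks) \<subseteq> (\<lambda>(x, xs). x # xs) ` (B k \<times> ?L ks)"
    by (auto simp: map_eq_Cons_conv image_iff)
  have fin: "finite (B k \<times> ?L ks)" using Cons assms by auto
  { case 1 show ?case using sub fin by (rule finite_subset[OF _ finite_imageI]) }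
  { case 2
    have "card (?L (k # ks)) \<le> card (B k \<times> ?L ks)"
      using sub fin by (rule surj_card_le[rotated])
    then show ?case using Cons by (simp add: card_cartesian_product order_trans[OF _ mult_le_mono2]) }
qed

section \<open>Random moduli\<close>

text \<open>This is \<open>(j + 1) ^ 3 - j ^ 3\<close>, so the digit lengths below \<open>k\<close>
  telescope to exactly \<open>k ^ 3\<close> bits.\<close>

definition dig :: "nat \<Rightarrow> nat" where
  "dig j = 3 * j\<^sup>2 + 3 * j + 1"

lemma sum_dig: "(\<Sum>j<k. dig j) = k ^ 3"
  by (induction k) (auto simp: dig_def power2_eq_square power3_eq_cube algebra_simps)

lemma dig_mono: "i \<le> j \<Longrightarrow> dig i \<le> dig j"
  by (auto simp: dig_def intro!: add_mono power_mono)

text \<open>Consecutive disjoint ranges make moduli with different indices distinct. The lower ends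
  multiply to \<open>2 ^ k ^ 3\<close> over \<open>j < k\<close> and the upper ends to
  \<open>2 ^ ((k + 1) ^ 3 - 1)\<close>, the same to leading order in the exponent.\<close>

definition moduli :: "nat \<Rightarrow> nat set" where
  "moduli j = {q. prime q \<and> 2 ^ dig j < q \<and> q \<le> 2 ^ dig (Suc j)}"

lemma finite_moduli [simp]: "finite (moduli j)"
  by (rule finite_subset[of _ "{..2 ^ dig (Suc j)}"]) (auto simp: moduli_def)

lemma prime_moduli: "p \<in> moduli j \<Longrightarrow> prime p"
  by (simp add: moduli_def)

lemma card_primes_Ioc_ge:
  "card {p::nat. prime p \<and> p \<le> b} \<le> card {p. prime p \<and> a < p \<and> p \<le> b} + a"
proof -
  have "{p::nat. prime p \<and> p \<le> b} \<subseteq> {p. prime p \<and> a < p \<and> p \<le> b} \<union> {1..a}"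
    by (auto dest: prime_gt_0_nat)
  then have "card {p::nat. prime p \<and> p \<le> b} \<le> card ({p. prime p \<and> a < p \<and> p \<le> b} \<union> {1..a})"
    by (rule card_mono[rotated]) (auto intro: finite_subset[of _ "{..b}"])
  also have "\<dots> \<le> card {p. prime p \<and> a < p \<and> p \<le> b} + card {1..a}"
    by (rule card_Un_le)
  finally show ?thesis by simp
qed

lemma card_moduli: "2 ^ dig j \<le> card (moduli j)"
proof -
  define M where "M = dig (Suc j)"
  have M: "M = dig j + (6 * j + 6)" by (simp add: M_def dig_def power2_eq_square)
  \<comment> \<open>The range spans \<open>6 * j + 6\<close> bits. This outweighs the factor
    \<open>M\<close> of the prime count and leaves enough to discard everything up to
    \<open>2 ^ dig j\<close>.\<close>
  have "2 * M + 1 \<le> 2 ^ (6 * j + 6)"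
    unfolding M_def dig_def
    by (induction j) (auto simp: power2_eq_square power_add)
  then have "2 ^ dig j * (2 * M + 1) \<le> 2 ^ M"
    unfolding M power_add by (rule mult_le_mono2)
  also have "2 ^ M \<le> M * card {p::nat. prime p \<and> p \<le> 2 ^ M} + 1"
    by (rule card_primes_le_power_two) (simp add: M)
  also have "\<dots> \<le> M * (card (moduli j) + 2 ^ dig j) + 1"
    unfolding moduli_def M_def[symmetric]
    by (intro add_mono mult_le_mono2 card_primes_Ioc_ge) auto
  finally have "M * 2 ^ dig j + 2 ^ dig j \<le> M * card (moduli j) + 1"
    by (simp add: algebra_simps)
  then have "M * 2 ^ dig j \<le> M * card (moduli j)"
    using one_le_power[of "2::nat" "dig j"] by linarith
  then show ?thesis by (simp add: M)
qed

lemma moduli_distinct: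
  assumes "p \<in> moduli i" "p \<in> moduli j" shows "i = j"
proof -
  have False if "p \<in> moduli i" "p \<in> moduli j" "i < j" for i j
  proof -
    have "p \<le> 2 ^ dig (Suc i)" "2 ^ dig j < p" using that by (auto simp: moduli_def)
    moreover have "(2::nat) ^ dig (Suc i) \<le> 2 ^ dig j"
      using that(3) by (intro power_increasing dig_mono) auto
    ultimately show False by linarith
  qed
  then show ?thesis using assms by (metis nat_neq_iff)
qed

section \<open>Products of the primes above a level, and their differences\<close>

lemma prime_dvd_prod_list_primes:
  fixes p :: nat
  assumes "prime p" "p dvd prod_list ys" "\<And>y. y \<in> set ys \<Longrightarrow> prime y"
  shows "p \<in> set ys"
  using assms(2,3)
proof (induction ys)
  case Nil
  then show ?case using assms(1) by (auto simp: prime_nat_iff)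
next
  case (Cons y ys)
  then show ?case using assms(1) primes_dvd_imp_eq[of p y] by (auto simp: prime_dvd_mult_iff)
qed

lemma prod_list_le_power_two:
  fixes xs :: "nat list"
  assumes "\<And>x. x \<in> set xs \<Longrightarrow> x \<le> 2 ^ f x"
  shows "prod_list xs \<le> 2 ^ (\<Sum>x\<leftarrow>xs. f x)"
  using assms by (induction xs) (auto simp: power_add intro!: mult_mono)

definition above_lev :: "('a \<Rightarrow> nat) \<Rightarrow> nat \<Rightarrow> 'a list \<Rightarrow> 'a list" where
  "above_lev f j = filter (\<lambda>x. j < f x)"

text \<open>Taking the distance of the two products turns a congruence modulo \<open>q\<close> into
  divisibility of one natural number, whose prime divisors can be counted once it is
  nonzero.\<close>

definition gap :: "(nat \<Rightarrow> nat) \<Rightarrow> nat list \<Rightarrow> nat list \<Rightarrow> nat \<Rightarrow> nat" where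
  "gap f xs ys j = nat \<bar>int (prod_list (above_lev f j xs)) - int (prod_list (above_lev f j ys))\<bar>"

lemma dvd_gap_iff:
  "q dvd gap f xs ys j \<longleftrightarrow> [prod_list (above_lev f j xs) = prod_list (above_lev f j ys)] (mod q)"
proof -
  have "q dvd gap f xs ys j \<longleftrightarrow>
      int q dvd int (prod_list (above_lev f j xs)) - int (prod_list (above_lev f j ys))"
    by (simp add: gap_def flip: int_dvd_int_iff)
  then show ?thesis by (simp flip: cong_int_iff cong_iff_dvd_diff)
qed

lemma gap_le: "gap f xs ys j \<le> max (prod_list (above_lev f j xs)) (prod_list (above_lev f j ys))"
  by (auto simp: gap_def)

text \<open>Unique factorisation: if the products were equal, the prime \<open>x\<close> would
  divide the product over \<open>ys\<close> and hence occur in \<open>ys\<close>.\<close>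

lemma gap_pos:
  assumes "\<And>x. x \<in> set xs \<union> set ys \<Longrightarrow> prime x" "set xs \<inter> set ys = {}"
    and "x \<in> set xs" "j < f x"
  shows "0 < gap f xs ys j"
proof (rule ccontr)
  assume "\<not> ?thesis"
  then have "prod_list (above_lev f j xs) = prod_list (above_lev f j ys)"
    by (simp add: gap_def)
  moreover have "x dvd prod_list (above_lev f j xs)"
  proof -
    have "x \<in> set (above_lev f j xs)" using assms(3,4) by (simp add: above_lev_def)
    then show ?thesis by (auto simp: in_set_conv_decomp)
  qed
  ultimately have "x \<in> set (above_lev f j ys)"
    using assms by (intro prime_dvd_prod_list_primes) (auto simp: above_lev_def)
  then show False using assms(2,3) by (auto simp: above_lev_def)
qed

text \<open>Primes of level \<open>k\<close> lie between \<open>2 ^ e (k - 1)\<close> and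
  \<open>2 ^ e k\<close>. By \<open>e_ge\<close> they exceed all moduli used for their digits. The
  term \<open>real k ^ 2\<close> in \<open>e_le\<close> saves a factor \<open>2 ^ K\<^sup>2\<close>
  in the count of coincidences, and \<open>many\<close> says that this saving pays for all
  lower-order factors and still leaves \<open>2 ^ (K + 2)\<close> to spare.\<close>

locale bh_construction =
  fixes h :: nat and e :: "nat \<Rightarrow> nat" and k0 :: nat and c :: real
  assumes h: "h \<ge> 1"
    and c: "0 < c" "c < 1" "c\<^sup>2 + 2 * (real h - 1) * c = 1"
    and e_mono: "mono e"
    and k0: "k0 \<ge> 1"
    and e_ge: "\<And>k. k \<ge> k0 \<Longrightarrow> dig k \<le> e (k - 1)"
    and e_le: "\<And>k. real (e k) \<le> c * (real k ^ 3 - real k ^ 2)"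
    and many: "\<And>K. K \<ge> k0 \<Longrightarrow>
      (real h + 1) * (real K + 1) ^ h * (real h * real (e K)) ^ K * 2 ^ (K + 2) * 2 ^ e K
      \<le> 2 ^ K\<^sup>2 * real (card {p::nat. prime p \<and> 2 ^ e (K - 1) < p \<and> p \<le> 2 ^ e K})"
begin

section \<open>Levels of primes and coincidences between them\<close>

definition lev :: "nat \<Rightarrow> nat" where
  "lev p = (LEAST k. p \<le> 2 ^ e k)"

lemma ex_lev: "\<exists>k. (p::nat) \<le> 2 ^ e k"
proof
  have "p \<le> dig (Suc (p + k0))" by (simp add: dig_def)
  also have "\<dots> \<le> e (p + k0)" using e_ge[of "Suc (p + k0)"] by simp
  also have "\<dots> \<le> 2 ^ e (p + k0)" by (simp add: less_imp_le)
  finally show "p \<le> 2 ^ e (p + k0)" .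
qed

lemma le_lev: "p \<le> 2 ^ e (lev p)"
  unfolding lev_def by (rule LeastI_ex[OF ex_lev])

lemma lev_le_iff: "lev p \<le> k \<longleftrightarrow> p \<le> 2 ^ e k"
proof
  assume "lev p \<le> k"
  then have "(2::nat) ^ e (lev p) \<le> 2 ^ e k"
    using e_mono by (intro power_increasing) (auto simp: mono_def)
  then show "p \<le> 2 ^ e k" using le_lev[of p] by linarith
qed (auto simp: lev_def intro: Least_le)

definition P :: "nat \<Rightarrow> nat set" where
  "P k = {p. prime p \<and> lev p = k}"

lemma P_eq: "K \<ge> 1 \<Longrightarrow> P K = {p. prime p \<and> 2 ^ e (K - 1) < p \<and> p \<le> 2 ^ e K}"
proof -
  assume "K \<ge> 1"
  then have "lev p = K \<longleftrightarrow> \<not> lev p \<le> K - 1 \<and> lev p \<le> K" for p by auto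
  then show ?thesis by (simp add: P_def lev_le_iff not_le)
qed

lemma finite_P: "finite (P K)"
  by (rule finite_subset[of _ "{..2 ^ e K}"]) (auto simp: P_def le_lev)

text \<open>By size: \<open>q\<close> is at most \<open>2 ^ dig (lev p)\<close>, which
  \<open>e_ge\<close> places below \<open>p\<close>. So the logarithms that form the digits of
  \<open>p\<close> are logarithms of units.\<close>

lemma not_dvd_if_moduli:
  assumes "prime p" "k0 \<le> lev p" "j < lev p" "q \<in> moduli j"
  shows "\<not> q dvd p"
proof
  assume "q dvd p"
  then have "q = p" using assms by (auto simp: moduli_def intro: primes_dvd_imp_eq)
  have "q \<le> 2 ^ dig (Suc j)" using assms by (simp add: moduli_def)
  also have "\<dots> \<le> 2 ^ dig (lev p)" using assms by (intro power_increasing dig_mono) auto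
  also have "\<dots> \<le> 2 ^ e (lev p - 1)" using assms by (intro power_increasing e_ge) auto
  also have "\<dots> < p" using lev_le_iff[of p "lev p - 1"] assms k0 by auto
  finally show False using \<open>q = p\<close> by simp
qed

text \<open>A coincidence of top level \<open>K\<close> is recorded as a pair of lists of primes with matching levels.
  The condition on \<open>hd xs\<close> singles out the prime that is deleted on account of the pair.\<close>

definition pre :: "nat \<Rightarrow> (nat list \<times> nat list) set" where
  "pre K = {(xs, ys). xs \<noteq> [] \<and> length xs \<le> h \<and> map lev ys = map lev xs \<and> lev (hd xs) = K \<and>
     (\<forall>x\<in>set xs \<union> set ys. prime x \<and> k0 \<le> lev x \<and> lev x \<le> K) \<and> set xs \<inter> set ys = {}}"

text \<open>Only the congruences implied by a coincidence of code sums are kept. They involve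
  \<open>q j\<close> for \<open>j < K\<close> alone, which is the locality that
  \<open>konig_choice\<close> asks for.\<close>

definition bad :: "(nat \<Rightarrow> nat) \<Rightarrow> nat \<Rightarrow> (nat list \<times> nat list) set" where
  "bad q K = {(xs, ys) \<in> pre K. \<forall>j<K. q j dvd gap lev xs ys j}"

lemma gap_pre:
  assumes "(xs, ys) \<in> pre K" "j < K"
  shows "0 < gap lev xs ys j" "gap lev xs ys j \<le> 2 ^ (\<Sum>k\<leftarrow>map lev xs. e k)"
proof -
  show "0 < gap lev xs ys j"
    using assms by (intro gap_pos[of _ _ "hd xs"]) (auto simp: pre_def)
  have "prod_list (above_lev lev j zs) \<le> 2 ^ (\<Sum>k\<leftarrow>map lev zs. e k)" for zs
  proof -
    have "prod_list (above_lev lev j zs) \<le> 2 ^ (\<Sum>z\<leftarrow>above_lev lev j zs. e (lev z))"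
      using le_lev by (intro prod_list_le_power_two) auto
    also have "\<dots> \<le> 2 ^ (\<Sum>z\<leftarrow>zs. e (lev z))"
      unfolding above_lev_def by (intro power_increasing) (induction zs, auto)
    finally show ?thesis by (simp add: o_def)
  qed
  note * = this
  have "map lev ys = map lev xs" using assms by (simp add: pre_def)
  then show "gap lev xs ys j \<le> 2 ^ (\<Sum>k\<leftarrow>map lev xs. e k)"
    using *[of xs] *[of ys] by (intro order_trans[OF gap_le] max.boundedI) simp_all
qed

text \<open>A crude bound is enough for counting prime divisors: the exponent \<open>h * e K\<close>
  enters only as their number, which is polynomial in \<open>K\<close>.\<close>

lemma gap_pre_le:
  assumes "(xs, ys) \<in> pre K" "j < K"
  shows "gap lev xs ys j \<le> 2 ^ (h * e K)"
proof -
  have "(\<Sum>x\<leftarrow>xs. e (lev x)) \<le> (\<Sum>x\<leftarrow>xs. e K)"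
    using assms e_mono by (intro sum_list_mono) (auto simp: pre_def mono_def)
  also have "\<dots> \<le> h * e K" using assms by (auto simp: pre_def sum_list_triv)
  finally have "(2::nat) ^ (\<Sum>k\<leftarrow>map lev xs. e k) \<le> 2 ^ (h * e K)"
    by (intro power_increasing) (auto simp: o_def)
  then show ?thesis using gap_pre(2)[OF assms] by linarith
qed

text \<open>If all digits below the smallest level agree, the full products are congruent modulo all
  of the corresponding moduli; as they differ, this bounds the smallest level.\<close>

lemma bad_min_level:
  assumes "(xs, ys) \<in> bad q K" "\<And>j. j < K \<Longrightarrow> q j \<in> moduli j"
  shows "(Min (set (map lev xs))) ^ 3 \<le> (\<Sum>k\<leftarrow>map lev xs. e k)"
proof -
  define l where "l = Min (set (map lev xs))"
  have pre: "(xs, ys) \<in> pre K" and dvd: "\<And>j. j < K \<Longrightarrow> q j dvd gap lev xs ys j"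
    using assms(1) by (auto simp: bad_def)
  have ne: "xs \<noteq> []" "lev (hd xs) = K" and lev: "map lev ys = map lev xs"
    using pre by (auto simp: pre_def)
  have lx: "l \<le> lev x" if "x \<in> set xs" for x
    unfolding l_def using that by (intro Min_le) auto
  have ly: "l \<le> lev y" if "y \<in> set ys" for y
  proof -
    have "lev y \<in> set (map lev ys)" using that by simp
    then show ?thesis unfolding lev l_def by (intro Min_le) auto
  qed
  have lK: "l \<le> K" using lx[of "hd xs"] ne by auto
  have "\<forall>x\<in>set xs. k0 \<le> lev x" using pre by (simp add: pre_def)
  then have K: "K > 0" using k0 ne by (metis hd_in_set less_le_trans zero_less_one)
  have gap_eq: "gap lev xs ys j = gap lev xs ys 0" if "j < l" for j
  proof -
    have "above_lev lev j xs = xs" "above_lev lev 0 xs = xs" "above_lev lev j ys = ys" "above_lev lev 0 ys = ys"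
      unfolding above_lev_def filter_id_conv using that lx ly by fastforce+
    then show ?thesis by (simp add: gap_def)
  qed
  have inj: "inj_on q {..<l}"
    using moduli_distinct assms(2) lK by (intro inj_onI) (metis lessThan_iff less_le_trans)
  have "2 ^ l ^ 3 = (\<Prod>j<l. (2::nat) ^ dig j)"
    by (simp add: sum_dig[symmetric] power_sum)
  also have "\<dots> \<le> (\<Prod>j<l. q j)"
    using assms(2) lK by (intro prod_mono) (auto simp: moduli_def intro: less_imp_le)
  also have "\<dots> = \<Prod>(q ` {..<l})" using inj by (simp add: prod.reindex)
  also have "\<dots> \<le> gap lev xs ys 0"
  proof (rule dvd_imp_le)
    show "\<Prod>(q ` {..<l}) dvd gap lev xs ys 0"
    proof -
      have "prime (q j) \<and> q j dvd gap lev xs ys 0" if "j < l" for j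
        using dvd[of j] gap_eq[of j] assms(2)[of j] lK that by (simp add: moduli_def)
      then show ?thesis by (intro prod_primes_dvd) auto
    qed
    show "0 < gap lev xs ys 0" using gap_pre(1)[OF pre K] .
  qed
  also have "\<dots> \<le> 2 ^ (\<Sum>k\<leftarrow>map lev xs. e k)" using gap_pre(2)[OF pre K] .
  finally have "l ^ 3 \<le> (\<Sum>k\<leftarrow>map lev xs. e k)"
    by (rule power_le_imp_le_exp[rotated]) simp
  then show ?thesis by (simp add: l_def)
qed

text \<open>This is where the exponent comes from: equality holds for \<open>h - 1\<close> primes of the top level
  together with one prime of the lowest admissible level.\<close>

lemma sum_exponents_le:
  assumes "ks \<noteq> []" "set ks \<subseteq> {..K}" "length ks \<le> h" "(Min (set ks)) ^ 3 \<le> (\<Sum>k\<leftarrow>ks. e k)"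
  shows "2 * real (\<Sum>k\<leftarrow>ks. e k) \<le> real (e K) + real (e K) / c"
proof -
  define l where "l = Min (set ks)"
  define S where "S = real (\<Sum>k\<leftarrow>ks. e k)"
  define E where "E = real (e K)"
  have lk: "l \<in> set ks" unfolding l_def using assms(1) by (intro Min_in) auto
  have "(\<Sum>k\<leftarrow>ks. e k) = e l + (\<Sum>k\<leftarrow>remove1 l ks. e k)"
    using lk by (rule sum_list_map_remove1)
  also have "(\<Sum>k\<leftarrow>remove1 l ks. e k) \<le> (\<Sum>k\<leftarrow>remove1 l ks. e K)"
    using assms(2) e_mono set_remove1_subset[of l ks] by (intro sum_list_mono) (auto simp: mono_def)
  also have "\<dots> \<le> (h - 1) * e K"
    using assms(3) lk by (auto simp: sum_list_triv length_remove1)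
  finally have "S \<le> real (e l + (h - 1) * e K)" unfolding S_def of_nat_le_iff by simp
  then have S: "S \<le> real (e l) + (real h - 1) * E"
    using h by (simp add: E_def of_nat_diff)
  \<comment> \<open>The condition on the minimum bounds the smallest term by \<open>c * S\<close>,
    so \<open>S\<close> appears on both sides and can be solved for.\<close>
  have "real (e l) \<le> c * (real l ^ 3 - real l ^ 2)" by (rule e_le)
  also have "\<dots> \<le> c * real l ^ 3" using c(1) by simp
  also have "\<dots> \<le> c * S"
  proof -
    have "real (l ^ 3) \<le> S" unfolding S_def l_def of_nat_le_iff by (rule assms(4))
    then show ?thesis using c(1) by simp
  qed
  finally have "S * (1 - c) \<le> (real h - 1) * E" using S by (simp add: algebra_simps)
  then have "2 * c * (S * (1 - c)) \<le> 2 * c * ((real h - 1) * E)"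
    using c(1) by (intro mult_left_mono) auto
  also have "\<dots> = (2 * (real h - 1) * c) * E" by (simp add: algebra_simps)
  \<comment> \<open>The quadratic equation for \<open>c\<close>, rearranged so that the factor
    \<open>1 - c\<close> cancels.\<close>
  also have "2 * (real h - 1) * c = (1 + c) * (1 - c)"
    using c(3) by (simp add: algebra_simps power2_eq_square)
  finally have "(1 - c) * (2 * c * S) \<le> (1 - c) * ((1 + c) * E)"
    by (simp add: algebra_simps)
  then have "2 * c * S \<le> (1 + c) * E" using c(2) by simp
  then have "2 * S \<le> E + E / c" using c(1) by (simp add: field_simps)
  then show ?thesis by (simp add: S_def E_def)
qed

section \<open>Expected number of coincidences\<close>

definition prof :: "nat \<Rightarrow> nat list set" where
  "prof K = {ks. ks \<noteq> [] \<and> set ks \<subseteq> {..K} \<and> length ks \<le> h \<and> (Min (set ks)) ^ 3 \<le> (\<Sum>k\<leftarrow>ks. e k)}"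

definition with_prof :: "nat list \<Rightarrow> nat list set" where
  "with_prof ks = {xs. map lev xs = ks \<and> (\<forall>x\<in>set xs. x \<in> {1..2 ^ e (lev x)})}"

text \<open>A finite superset of \<open>bad q K\<close> that does not depend on \<open>q\<close>, so
  that the sums over pairs and over choices of moduli can be exchanged.\<close>

definition cand :: "nat \<Rightarrow> (nat list \<times> nat list) set" where
  "cand K = (\<Union>ks\<in>prof K. with_prof ks \<times> with_prof ks)"

lemma prof_finite_card: "finite (prof K)" "card (prof K) \<le> (h + 1) * (K + 1) ^ h"
proof -
  have sub: "prof K \<subseteq> {ks. set ks \<subseteq> {..K} \<and> length ks \<le> h}" by (auto simp: prof_def)
  have fin: "finite {ks. set ks \<subseteq> {..K} \<and> length ks \<le> h}"
    by (rule finite_lists_length_le) simp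
  show "finite (prof K)" using sub fin by (rule finite_subset)
  have "card (prof K) \<le> (\<Sum>i\<le>h. (K + 1) ^ i)"
    using card_mono[OF fin sub] card_lists_length_le[of "{..K}" h] by simp
  also have "\<dots> \<le> (\<Sum>i\<le>h. (K + 1) ^ h)"
    by (intro sum_mono power_increasing) auto
  finally show "card (prof K) \<le> (h + 1) * (K + 1) ^ h" by simp
qed

lemma with_prof_finite_card: "finite (with_prof ks)" "card (with_prof ks) \<le> 2 ^ (\<Sum>k\<leftarrow>ks. e k)"
proof -
  show "finite (with_prof ks)"
    unfolding with_prof_def by (rule card_map_eq_le(1)) simp
  have "card (with_prof ks) \<le> (\<Prod>k\<leftarrow>ks. card {1::nat..2 ^ e k})"
    unfolding with_prof_def by (rule card_map_eq_le(2)) simp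
  also have "\<dots> = 2 ^ (\<Sum>k\<leftarrow>ks. e k)"
    by (induction ks) (auto simp: power_add)
  finally show "card (with_prof ks) \<le> 2 ^ (\<Sum>k\<leftarrow>ks. e k)" .
qed

lemma bad_subset_cand:
  assumes "\<And>j. j < K \<Longrightarrow> q j \<in> moduli j"
  shows "bad q K \<subseteq> cand K"
proof
  fix z assume z: "z \<in> bad q K"
  obtain xs ys where xy: "z = (xs, ys)" by force
  have pre: "(xs, ys) \<in> pre K" using z xy by (auto simp: bad_def)
  have "map lev xs \<in> prof K"
    using bad_min_level[OF z[unfolded xy] assms] pre unfolding prof_def by (auto simp: pre_def)
  moreover have "xs \<in> with_prof (map lev xs)" "ys \<in> with_prof (map lev xs)"
    using pre le_lev by (auto simp: with_prof_def pre_def Suc_le_eq prime_gt_0_nat)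
  ultimately show "z \<in> cand K" unfolding cand_def xy by blast
qed

text \<open>A profile with exponent sum \<open>s\<close> admits at most \<open>2 ^ (2 * s)\<close>
  pairs. Here \<open>sum_exponents_le\<close> bounds \<open>2 * s\<close>, and \<open>e_le\<close>
  replaces \<open>e K / c\<close> by \<open>K ^ 3 - K ^ 2\<close>; for fixed \<open>h\<close> there
  are only polynomially many profiles.\<close>

lemma cand_finite_card:
  "finite (cand K)" "real (card (cand K)) \<le> (real h + 1) * (real K + 1) ^ h * 2 ^ e K * 2 powr (real K ^ 3 - real K ^ 2)"
proof -
  show "finite (cand K)"
    unfolding cand_def using prof_finite_card with_prof_finite_card by auto
  have bound: "real (card (with_prof ks \<times> with_prof ks)) \<le> 2 ^ e K * 2 powr (real K ^ 3 - real K ^ 2)"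
    if "ks \<in> prof K" for ks
  proof -
    define s where "s = (\<Sum>k\<leftarrow>ks. e k)"
    have "real (card (with_prof ks \<times> with_prof ks)) \<le> 2 ^ s * 2 ^ s"
    proof -
      have "real (card (with_prof ks)) \<le> real (2 ^ s)"
        unfolding s_def of_nat_le_iff by (rule with_prof_finite_card(2))
      then show ?thesis
        unfolding card_cartesian_product of_nat_mult by (intro mult_mono) auto
    qed
    also have "\<dots> = 2 powr (2 * real s)"
      by (simp add: powr_realpow[symmetric] powr_add[symmetric])
    also have "\<dots> \<le> 2 powr (real (e K) + real (e K) / c)"
      using that unfolding s_def
      by (intro powr_mono sum_exponents_le) (auto simp: prof_def)
    also have "\<dots> \<le> 2 powr (real (e K) + (real K ^ 3 - real K ^ 2))"
      using e_le[of K] c(1) by (intro powr_mono) (auto simp: field_simps)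
    also have "\<dots> = 2 ^ e K * 2 powr (real K ^ 3 - real K ^ 2)"
      by (simp add: powr_add powr_realpow)
    finally show ?thesis .
  qed
  have "real (card (cand K)) \<le> real (\<Sum>ks\<in>prof K. card (with_prof ks \<times> with_prof ks))"
    unfolding cand_def of_nat_le_iff by (intro card_UN_le prof_finite_card)
  also have "\<dots> \<le> real (card (prof K)) * (2 ^ e K * 2 powr (real K ^ 3 - real K ^ 2))"
    unfolding of_nat_sum using bound by (intro sum_bounded_above) auto
  also have "\<dots> \<le> real ((h + 1) * (K + 1) ^ h) * (2 ^ e K * 2 powr (real K ^ 3 - real K ^ 2))"
    using prof_finite_card(2)[of K] by (intro mult_right_mono) (simp_all only: of_nat_le_iff, simp)
  finally show "real (card (cand K)) \<le> (real h + 1) * (real K + 1) ^ h * 2 ^ e K * 2 powr (real K ^ 3 - real K ^ 2)"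
    by (simp add: algebra_simps)
qed

text \<open>First moment method. The factor \<open>2 ^ K ^ 3\<close> from the moduli cancels the
  main term of the number of candidates, and \<open>many\<close> absorbs what remains.\<close>

lemma sum_card_bad_le:
  assumes "k0 \<le> K" "K \<le> n"
  defines "\<Omega> \<equiv> PiE {..<n} moduli"
  shows "(\<Sum>q\<in>\<Omega>. real (card (bad q K))) \<le> real (card \<Omega>) * real (card (P K)) / 2 ^ (K + 2)"
proof -
  \<comment> \<open>Bounds the proportion of choices for which a given pair is bad: at most
    \<open>h * e K\<close> primes divide each gap, out of at least \<open>2 ^ dig j\<close>, and the
    lengths telescope.\<close>
  define \<rho> where "\<rho> = (real h * real (e K)) ^ K / 2 ^ K ^ 3"
  have fin: "finite \<Omega>" unfolding \<Omega>_def by (intro finite_PiE) auto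
  have "real (card (bad q K)) = (\<Sum>z\<in>cand K. if z \<in> bad q K then 1 else 0)" if "q \<in> \<Omega>" for q
  proof -
    have "q j \<in> moduli j" if "j < K" for j
      using \<open>q \<in> \<Omega>\<close> assms(2) that unfolding \<Omega>_def by (intro PiE_mem[of q "{..<n}"]) auto
    then have "bad q K \<subseteq> cand K" by (rule bad_subset_cand)
    then have "cand K \<inter> {z. z \<in> bad q K} = bad q K" by auto
    then show ?thesis using cand_finite_card(1)[of K] by (simp add: sum.If_cases)
  qed
  then have "(\<Sum>q\<in>\<Omega>. real (card (bad q K))) = (\<Sum>q\<in>\<Omega>. \<Sum>z\<in>cand K. if z \<in> bad q K then 1 else 0)"
    by (intro sum.cong) auto
  also have "\<dots> = (\<Sum>z\<in>cand K. \<Sum>q\<in>\<Omega>. if z \<in> bad q K then 1 else 0)"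
    by (rule sum.swap)
  also have "\<dots> = (\<Sum>z\<in>cand K. real (card {q \<in> \<Omega>. z \<in> bad q K}))"
    using fin by (intro sum.cong) (auto simp: sum.If_cases Int_def)
  also have "\<dots> \<le> real (card (cand K)) * (real (card \<Omega>) * \<rho>)"
  proof (rule sum_bounded_above)
    fix z :: "nat list \<times> nat list"
    obtain xs ys where z: "z = (xs, ys)" by force
    show "real (card {q \<in> \<Omega>. z \<in> bad q K}) \<le> real (card \<Omega>) * \<rho>"
    proof (cases "z \<in> pre K")
      case True
      have "real (card {q \<in> PiE {..<n} moduli. \<forall>j<K. q j dvd gap lev xs ys j})
          \<le> real (card (PiE {..<n} moduli)) * (real (h * e K) ^ K / (\<Prod>j<K. real (2 ^ dig j)))"
        using True gap_pre(1) gap_pre_le card_moduli assms(2) prime_moduli unfolding z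
        by (intro card_PiE_dvd_le) auto
      moreover have "(\<Prod>j<K. real (2 ^ dig j)) = 2 ^ K ^ 3"
        by (simp add: sum_dig[symmetric] power_sum)
      moreover have "{q \<in> \<Omega>. z \<in> bad q K} = {q \<in> PiE {..<n} moduli. \<forall>j<K. q j dvd gap lev xs ys j}"
        using True by (auto simp: \<Omega>_def bad_def z)
      ultimately show ?thesis by (simp add: \<rho>_def \<Omega>_def)
    next
      case False
      then have "{q \<in> \<Omega>. z \<in> bad q K} = {}" by (auto simp: bad_def)
      then show ?thesis by (simp only: card.empty) (simp add: \<rho>_def)
    qed
  qed
  also have "\<dots> = real (card \<Omega>) * (real (card (cand K)) * \<rho>)" by simp
  also have "\<dots> \<le> real (card \<Omega>) * (real (card (P K)) / 2 ^ (K + 2))"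
  proof (rule mult_left_mono)
    have pw: "2 powr (real K ^ 3 - real K ^ 2) = 2 ^ K ^ 3 / 2 ^ K\<^sup>2"
      by (simp add: powr_diff powr_realpow flip: of_nat_power)
    have "real (card (cand K)) * \<rho> \<le>
        ((real h + 1) * (real K + 1) ^ h * 2 ^ e K * 2 powr (real K ^ 3 - real K ^ 2)) * \<rho>"
      using cand_finite_card(2)[of K] by (intro mult_right_mono) (auto simp: \<rho>_def)
    also have "\<dots> = ((real h + 1) * (real K + 1) ^ h * (real h * real (e K)) ^ K * 2 ^ (K + 2) * 2 ^ e K)
        / (2 ^ K\<^sup>2 * 2 ^ (K + 2))"
      by (simp add: \<rho>_def pw field_simps)
    also have "\<dots> \<le> (2 ^ K\<^sup>2 * real (card (P K))) / (2 ^ K\<^sup>2 * 2 ^ (K + 2))"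
      using many[OF assms(1)] P_eq[of K] assms(1) k0 by (intro divide_right_mono) auto
    also have "\<dots> = real (card (P K)) / 2 ^ (K + 2)" by simp
    finally show "real (card (cand K)) * \<rho> \<le> real (card (P K)) / 2 ^ (K + 2)" .
  qed simp
  finally show ?thesis by simp
qed

end

section \<open>Coding primes by their discrete logarithms\<close>

lemma sum_mset_le_size_mult:
  fixes f :: "'a \<Rightarrow> nat"
  assumes "\<And>x. x \<in># M \<Longrightarrow> f x \<le> b"
  shows "(\<Sum>x\<in>#M. f x) \<le> size M * b"
  using assms by (induction M) (auto intro: add_mono)

text \<open>The multiplicity of a level is the difference of two consecutive threshold counts; for
  level 0 the larger count is the total size.\<close>

lemma size_filter_levels_eq_imp_image_mset_eq:
  fixes f :: "'a \<Rightarrow> nat"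
  assumes "size M = size N"
    and "\<And>j. size (filter_mset (\<lambda>x. j < f x) M) = size (filter_mset (\<lambda>x. j < f x) N)"
  shows "image_mset f M = image_mset f N"
proof (rule multiset_eqI)
  fix k
  have split: "size (filter_mset (\<lambda>x. k \<le> f x) L) =
      count (image_mset f L) k + size (filter_mset (\<lambda>x. k < f x) L)" for L
    by (induction L) auto
  have "size (filter_mset (\<lambda>x. k \<le> f x) M) = size (filter_mset (\<lambda>x. k \<le> f x) N)"
    using assms by (cases k) (auto simp: Suc_le_eq)
  then show "count (image_mset f M) k = count (image_mset f N) k"
    using split[of M] split[of N] assms(2)[of k] by simp
qed

text \<open>Used to list the second side of a coincidence so that levels match position by position,
  as \<open>pre\<close> requires.\<close>

lemma ex_mset_map_eq:
  assumes "mset (map f xs) = image_mset f N"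
  obtains ys where "mset ys = N" "map f ys = map f xs"
proof -
  obtain ys0 where ys0: "mset ys0 = N" using ex_mset by blast
  have "list_all2 (\<lambda>k y. k = f y) (map f ys0) ys0"
    by (simp add: list_all2_conv_all_nth)
  moreover have "mset (map f xs) = mset (map f ys0)" using assms ys0 by simp
  ultimately obtain ys where ys: "list_all2 (\<lambda>k y. k = f y) (map f xs) ys" "mset ys = mset ys0"
    using list_all2_reorder_left_invariance by blast
  from ys(1) have "map f ys = map f xs"
    by (auto simp: list_all2_conv_all_nth intro!: nth_equalityI)
  then show thesis using that ys(2) ys0 by simp
qed

context bh_construction
begin

lemma card_P_pos:
  assumes "k0 \<le> K" shows "card (P K) > 0"
proof -
  have "e K \<ge> 1"
    using e_ge[OF assms] e_mono monoD[of e "K - 1" K] by (simp add: dig_def)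
  then have "0 < (real h + 1) * (real K + 1) ^ h * (real h * real (e K)) ^ K * 2 ^ (K + 2) * 2 ^ e K"
    using h by (intro mult_pos_pos zero_less_power) auto
  also have "\<dots> \<le> 2 ^ K\<^sup>2 * real (card (P K))"
    using many[OF assms] assms k0 by (subst P_eq) auto
  finally show ?thesis by (simp add: zero_less_mult_iff)
qed

text \<open>Averaging: if every choice failed at some \<open>K\<close>, the sum over
  \<open>K\<close> of \<open>2 * card (bad q K) / card (P K)\<close> would be at least 1 for each
  \<open>q\<close>, whereas its mean is at most a sum of \<open>1 / 2 ^ (K + 1)\<close>, which is
  below 1.\<close>

lemma ex_good_moduli_upto:
  "\<exists>q. (\<forall>j<n. q j \<in> moduli j) \<and> (\<forall>K\<le>n. k0 \<le> K \<longrightarrow> 2 * card (bad q K) \<le> card (P K))"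
proof (rule ccontr)
  assume neg: "\<not> ?thesis"
  define \<Omega> where "\<Omega> = PiE {..<n} moduli"
  have "moduli j \<noteq> {}" for j
    using card_moduli[of j] by (metis card.empty not_le zero_less_numeral zero_less_power)
  then have ne: "\<Omega> \<noteq> {}" by (simp add: \<Omega>_def PiE_eq_empty_iff)
  have fin: "finite \<Omega>" unfolding \<Omega>_def by (intro finite_PiE) auto
  have ge1: "1 \<le> (\<Sum>K=k0..n. 2 * real (card (bad q K)) / real (card (P K)))" if q: "q \<in> \<Omega>" for q
  proof -
    have "q j \<in> moduli j" if "j < n" for j
      using q that unfolding \<Omega>_def by (intro PiE_mem[of q "{..<n}"]) auto
    then obtain K where K: "K \<le> n" "k0 \<le> K" "card (P K) < 2 * card (bad q K)"
      using neg by (meson not_le)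
    have "1 \<le> 2 * real (card (bad q K)) / real (card (P K))"
      using K card_P_pos[OF K(2)] by simp
    also have "\<dots> \<le> (\<Sum>K=k0..n. 2 * real (card (bad q K)) / real (card (P K)))"
      using K by (intro member_le_sum) auto
    finally show ?thesis .
  qed
  have geo: "(\<Sum>K=k0..n. 1 / 2 ^ (K + 1)) < (1::real)"
  proof -
    have "(\<Sum>K=k0..n. 1 / 2 ^ (K + 1)) \<le> (\<Sum>K<Suc n. 1 / 2 ^ (K + 1) :: real)"
      by (intro sum_mono2) auto
    also have "\<dots> = 1 - 1 / 2 ^ Suc n" by (induction n) (auto simp: field_simps)
    finally show ?thesis by (simp add: order.strict_trans1)
  qed
  have "real (card \<Omega>) \<le> (\<Sum>q\<in>\<Omega>. \<Sum>K=k0..n. 2 * real (card (bad q K)) / real (card (P K)))"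
    using sum_mono[of \<Omega> "\<lambda>_. 1", OF ge1] by simp
  also have "\<dots> = (\<Sum>K=k0..n. 2 / real (card (P K)) * (\<Sum>q\<in>\<Omega>. real (card (bad q K))))"
    by (subst sum.swap) (simp add: sum_distrib_left)
  also have "\<dots> \<le> (\<Sum>K=k0..n. real (card \<Omega>) * (1 / 2 ^ (K + 1)))"
  proof (rule sum_mono)
    fix K assume K: "K \<in> {k0..n}"
    then have "2 / real (card (P K)) * (\<Sum>q\<in>\<Omega>. real (card (bad q K)))
        \<le> 2 / real (card (P K)) * (real (card \<Omega>) * real (card (P K)) / 2 ^ (K + 2))"
      unfolding \<Omega>_def by (intro mult_left_mono sum_card_bad_le) auto
    also have "\<dots> = real (card \<Omega>) * (1 / 2 ^ (K + 1))"
      using K card_P_pos[of K] by (simp add: field_simps)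
    finally show "2 / real (card (P K)) * (\<Sum>q\<in>\<Omega>. real (card (bad q K)))
        \<le> real (card \<Omega>) * (1 / 2 ^ (K + 1))" .
  qed
  also have "\<dots> = real (card \<Omega>) * (\<Sum>K=k0..n. 1 / 2 ^ (K + 1))"
    by (simp add: sum_distrib_left)
  also have "\<dots> < real (card \<Omega>) * 1"
    using geo ne fin by (intro mult_strict_left_mono) (auto simp: card_gt_0_iff)
  finally show False by simp
qed

lemma ex_good_moduli:
  "\<exists>q. \<forall>j. q j \<in> moduli j \<and> (k0 \<le> j \<longrightarrow> 2 * card (bad q j) \<le> card (P j))"
proof (rule konig_choice[where Good = "\<lambda>K q. k0 \<le> K \<longrightarrow> 2 * card (bad q K) \<le> card (P K)"])
  show "k0 \<le> K \<longrightarrow> 2 * card (bad q' K) \<le> card (P K)"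
    if "\<And>j. j < K \<Longrightarrow> q j = q' j" "k0 \<le> K \<longrightarrow> 2 * card (bad q K) \<le> card (P K)" for K q q'
  proof -
    have "bad q K = bad q' K" using that(1) by (auto simp: bad_def)
    then show ?thesis using that(2) by simp
  qed
  show "\<exists>q. (\<forall>j<n. q j \<in> moduli j) \<and> (\<forall>K\<le>n. k0 \<le> K \<longrightarrow> 2 * card (bad q K) \<le> card (P K))" for n
    by (rule ex_good_moduli_upto)
qed simp

end

section \<open>Codes of primes and addition without carries\<close>

locale bh_coding = bh_construction +
  fixes q :: "nat \<Rightarrow> nat"
  assumes q: "\<And>j. q j \<in> moduli j"
    and good: "\<And>K. k0 \<le> K \<Longrightarrow> 2 * card (bad q K) \<le> card (P K)"
begin

text \<open>A digit is less than \<open>(h + 1) * 2 ^ dig (Suc j)\<close>, so this radix admits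
  \<open>h\<close> summands without a carry.\<close>

definition base :: "nat \<Rightarrow> nat" where
  "base j = h * (h + 1) * 2 ^ dig (Suc j)"

text \<open>The offset makes each digit of a sum of codes reveal the number of summands that reach this
  digit, in addition to the sum of their discrete logarithms.\<close>

definition digit :: "nat \<Rightarrow> nat \<Rightarrow> nat" where
  "digit j p = h * 2 ^ dig (Suc j) + dlog (q j) p"

definition code :: "nat \<Rightarrow> nat" where
  "code p = (\<Sum>j<lev p. digit j p * (\<Prod>i<j. base i))"

definition R :: "nat set" where
  "R = {p. prime p \<and> k0 \<le> lev p \<and> p \<notin> (hd \<circ> fst) ` bad q (lev p)}"

lemma dlog_less:
  assumes "p \<in> R" "j < lev p"
  shows "dlog (q j) p < 2 ^ dig (Suc j)"
proof -
  have "dlog (q j) p < q j"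
    using assms not_dvd_if_moduli[OF _ _ _ q] prime_moduli[OF q] by (intro dlog) (auto simp: R_def)
  then show ?thesis using q[of j] by (simp add: moduli_def)
qed

lemma sum_code:
  assumes "\<And>p. p \<in># M \<Longrightarrow> lev p \<le> n"
  shows "(\<Sum>p\<in>#M. code p) =
    (\<Sum>j<n. (\<Sum>p\<in>#filter_mset (\<lambda>p. j < lev p) M. digit j p) * (\<Prod>i<j. base i))"
  using assms
proof (induction M)
  case (add p M)
  have "code p = (\<Sum>j<n. (if j < lev p then digit j p else 0) * (\<Prod>i<j. base i))"
    unfolding code_def using add.prems by (intro sum.mono_neutral_cong_left) auto
  moreover have "(\<Sum>p\<in>#filter_mset (\<lambda>p. j < lev p) (add_mset p M). digit j p) =
      (if j < lev p then digit j p else 0) + (\<Sum>p\<in>#filter_mset (\<lambda>p. j < lev p) M. digit j p)" for j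
    by simp
  ultimately show ?case
    using add.IH add.prems by (simp only: distrib_right sum.distrib) simp
qed simp

lemma sum_digit:
  "(\<Sum>p\<in>#F. digit j p) = size F * (h * 2 ^ dig (Suc j)) + (\<Sum>p\<in>#F. dlog (q j) p)"
  by (induction F) (auto simp: digit_def)

lemma sum_dlog_less:
  assumes "set_mset F \<subseteq> R" "size F \<le> h" "\<And>p. p \<in># F \<Longrightarrow> j < lev p"
  shows "(\<Sum>p\<in>#F. dlog (q j) p) < h * 2 ^ dig (Suc j)"
proof -
  have "(\<Sum>p\<in>#F. dlog (q j) p) \<le> size F * (2 ^ dig (Suc j) - 1)"
    using assms dlog_less[of _ j] by (intro sum_mset_le_size_mult) fastforce
  also have "\<dots> \<le> h * (2 ^ dig (Suc j) - 1)" using assms(2) by (rule mult_le_mono1)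
  also have "\<dots> < h * 2 ^ dig (Suc j)" using h by simp
  finally show ?thesis .
qed

text \<open>Without carries the digit sums agree. Each is a multiple of
  \<open>h * 2 ^ dig (Suc j)\<close> plus a smaller sum of logarithms, so division with remainder
  separates the number of summands from that sum.\<close>

lemma sum_code_eq_imp:
  assumes "set_mset M \<subseteq> R" "set_mset N \<subseteq> R" "size M \<le> h" "size N \<le> h"
    and "(\<Sum>p\<in>#M. code p) = (\<Sum>p\<in>#N. code p)"
  shows "size (filter_mset (\<lambda>p. j < lev p) M) = size (filter_mset (\<lambda>p. j < lev p) N)"
    and "(\<Sum>p\<in>#filter_mset (\<lambda>p. j < lev p) M. dlog (q j) p)
       = (\<Sum>p\<in>#filter_mset (\<lambda>p. j < lev p) N. dlog (q j) p)"
proof -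
  define F where "F = (\<lambda>j. filter_mset (\<lambda>p. j < lev p))"
  define n where "n = Suc (j + (\<Sum>p\<in>#M + N. lev p))"
  have n: "lev p \<le> n" if "p \<in># M + N" for p
  proof -
    obtain L where "M + N = add_mset p L" using \<open>p \<in># M + N\<close> by (metis insert_DiffM)
    then show ?thesis unfolding n_def by simp
  qed
  have sz: "size (F i L) \<le> h" if "size L \<le> h" for i L
    unfolding F_def by (rule order_trans[OF size_filter_mset_lesseq that])
  have dlt: "(\<Sum>p\<in>#F i L. dlog (q i) p) < h * 2 ^ dig (Suc i)"
    if "set_mset L \<subseteq> R" "size L \<le> h" for i L
    using that sz[OF that(2)] by (intro sum_dlog_less) (auto simp: F_def)
  have lt: "(\<Sum>p\<in>#F i L. digit i p) < base i"
    if "set_mset L \<subseteq> R" "size L \<le> h" for i L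
  proof -
    have "(\<Sum>p\<in>#F i L. digit i p) < h * (h * 2 ^ dig (Suc i)) + h * 2 ^ dig (Suc i)"
      unfolding sum_digit using dlt[OF that] sz[OF that(2)] by (intro add_le_less_mono mult_le_mono1)
    then show ?thesis by (simp add: base_def algebra_simps)
  qed
  have "(\<Sum>p\<in>#F j M. digit j p) = (\<Sum>p\<in>#F j N. digit j p)"
  proof (rule mixed_radix_inj[where B = base and n = n and u = "\<lambda>j. \<Sum>p\<in>#F j M. digit j p"
        and v = "\<lambda>j. \<Sum>p\<in>#F j N. digit j p"])
    show "(\<Sum>j<n. (\<Sum>p\<in>#F j M. digit j p) * (\<Prod>i<j. base i))
        = (\<Sum>j<n. (\<Sum>p\<in>#F j N. digit j p) * (\<Prod>i<j. base i))"
      using assms(5) sum_code[of M n] sum_code[of N n] n by (simp add: F_def)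
  qed (use lt assms in \<open>auto simp: n_def\<close>)
  then have eq: "(\<Sum>p\<in>#F j M. dlog (q j) p) + size (F j M) * (h * 2 ^ dig (Suc j)) =
      (\<Sum>p\<in>#F j N. dlog (q j) p) + size (F j N) * (h * 2 ^ dig (Suc j))"
    unfolding sum_digit by simp
  note d = dlt[OF assms(1,3), of j] dlt[OF assms(2,4), of j]
  show "(\<Sum>p\<in>#F j M. dlog (q j) p) = (\<Sum>p\<in>#F j N. dlog (q j) p)"
    using arg_cong[OF eq, of "\<lambda>x. x mod (h * 2 ^ dig (Suc j))"] d by simp
  then show "size (F j M) = size (F j N)" using eq h by simp
qed

text \<open>After cancelling the common part, the two sides are disjoint with equal levels and
  congruent products. They would form a bad pair, and its designated prime does not belong to
  \<open>R\<close>.\<close>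

lemma mset_eq_if_sum_code_eq:
  assumes "set_mset M \<subseteq> R" "set_mset N \<subseteq> R" "size M = size N" "size M \<le> h"
    and "(\<Sum>p\<in>#M. code p) = (\<Sum>p\<in>#N. code p)"
  shows "M = N"
proof (rule ccontr)
  assume "M \<noteq> N"
  define M' where "M' = M - N"
  define N' where "N' = N - M"
  have MN: "M = (M \<inter># N) + M'" "N = (M \<inter># N) + N'"
    unfolding M'_def N'_def by (auto simp: multiset_eq_iff)
  have disj: "set_mset M' \<inter> set_mset N' = {}"
    unfolding M'_def N'_def by (auto simp: in_diff_count)
  have subR: "set_mset M' \<subseteq> R" "set_mset N' \<subseteq> R"
    using assms(1,2) unfolding M'_def N'_def by (auto dest: in_diffD)
  have size': "size M' = size N'"
    using arg_cong[OF MN(1), of size] arg_cong[OF MN(2), of size] assms(3) by simp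
  have sizeh: "size M' \<le> h" using arg_cong[OF MN(1), of size] assms(4) by simp
  have sum': "(\<Sum>p\<in>#M'. code p) = (\<Sum>p\<in>#N'. code p)"
    using arg_cong[OF MN(1), of "\<lambda>M. \<Sum>p\<in>#M. code p"]
      arg_cong[OF MN(2), of "\<lambda>M. \<Sum>p\<in>#M. code p"] assms(5) by simp
  have ne: "M' \<noteq> {#}"
    using MN size' \<open>M \<noteq> N\<close> by (metis size_0 size_eq_0_iff_empty)
  note eqs = sum_code_eq_imp[OF subR sizeh _ sum']
  have levs: "image_mset lev M' = image_mset lev N'"
    using eqs size' sizeh by (intro size_filter_levels_eq_imp_image_mset_eq) auto
  define K where "K = Max (lev ` set_mset M')"
  have "K \<in> lev ` set_mset M'" unfolding K_def using ne by (intro Max_in) auto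
  then obtain p where p: "p \<in># M'" "lev p = K" by auto
  have leK: "lev x \<le> K" if "x \<in># M'" for x unfolding K_def using that by (intro Max_ge) auto
  \<comment> \<open>A prime of top level is put first, since the head of the list is the prime
    deleted for the pair.\<close>
  obtain xs' where xs': "mset xs' = M' - {#p#}" using ex_mset by blast
  define xs where "xs = p # xs'"
  have xs: "mset xs = M'" using p by (simp add: xs_def xs')
  obtain ys where ys: "mset ys = N'" "map lev ys = map lev xs"
    using ex_mset_map_eq[of lev xs N'] xs levs by auto
  have setxs: "set xs = set_mset M'" and setys: "set ys = set_mset N'"
    using xs ys by (metis set_mset_mset)+
  have leK': "lev y \<le> K" if "y \<in> set ys" for y
  proof -
    have "lev y \<in> set (map lev ys)" using that by simp
    then show ?thesis unfolding ys(2) using leK setxs by auto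
  qed
  have "(xs, ys) \<in> pre K"
  proof -
    have "length xs \<le> h" using sizeh xs size_mset[of xs] by simp
    moreover have "\<forall>x\<in>set xs \<union> set ys. prime x \<and> k0 \<le> lev x \<and> lev x \<le> K"
      using leK leK' subR unfolding setxs setys by (auto simp: R_def subset_iff setys)
    moreover have "set xs \<inter> set ys = {}" using disj unfolding setxs setys .
    moreover have "xs \<noteq> []" "lev (hd xs) = K" using p by (auto simp: xs_def)
    ultimately show ?thesis unfolding pre_def using ys(2) by simp
  qed
  moreover have "q j dvd gap lev xs ys j" for j
    unfolding dvd_gap_iff
  proof -
    have "[prod_mset (filter_mset (\<lambda>p. j < lev p) M') = prod_mset (filter_mset (\<lambda>p. j < lev p) N')]
        (mod q j)"
      using subR sizeh size' eqs(2)[of j] prime_moduli[OF q] not_dvd_if_moduli[OF _ _ _ q]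
      by (intro cong_prod_mset_if_sum_dlog_eq) (auto simp: R_def)
    then show "[prod_list (above_lev lev j xs) = prod_list (above_lev lev j ys)] (mod q j)"
      by (simp add: above_lev_def xs[symmetric] ys(1)[symmetric] prod_mset_prod_list flip: mset_filter)
  qed
  ultimately have "(xs, ys) \<in> bad q K" by (simp add: bad_def)
  then have "p \<in> (hd \<circ> fst) ` bad q (lev p)"
    using p(2) by (auto simp: xs_def intro!: rev_image_eqI)
  then show False using p(1) subR(1) by (auto simp: R_def)
qed

lemma inj_on_code: "inj_on code R"
proof (rule inj_onI)
  fix x y assume "x \<in> R" "y \<in> R" "code x = code y"
  then have "{#x#} = {#y#}" using h by (intro mset_eq_if_sum_code_eq) auto
  then show "x = y" by simp
qed

text \<open>The offset \<open>h * 2 ^ dig (Suc j)\<close> makes the top digit nonzero, so the size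
  of a code reflects the level of its prime.\<close>

lemma code_bounds:
  assumes "p \<in> R"
  shows "(\<Prod>i<lev p - 1. base i) \<le> code p" "code p < (\<Prod>i<lev p. base i)"
proof -
  obtain k where k: "lev p = Suc k" using assms k0 by (cases "lev p") (auto simp: R_def)
  have "1 \<le> digit k p" using h by (simp add: digit_def add_increasing2 Suc_le_eq)
  then have "(\<Prod>i<k. base i) \<le> digit k p * (\<Prod>i<k. base i)" by (cases "digit k p") auto
  then show "(\<Prod>i<lev p - 1. base i) \<le> code p"
    unfolding code_def k sum.lessThan_Suc diff_Suc_1 by (intro trans_le_add2)
  have "digit j p < base j" if "j < lev p" for j
  proof -
    have "digit j p < h * 2 ^ dig (Suc j) + 2 ^ dig (Suc j)"
      using dlog_less[OF assms that] by (simp add: digit_def)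
    also have "\<dots> = 1 * (h + 1) * 2 ^ dig (Suc j)" by simp
    also have "\<dots> \<le> base j" unfolding base_def using h by (intro mult_le_mono1) auto
    finally show ?thesis .
  qed
  then show "code p < (\<Prod>i<lev p. base i)" unfolding code_def by (rule mixed_radix_less)
qed

lemma base_pos: "base j > 0"
  using h by (simp add: base_def)

lemma B_seq_code: "B_seq h (code ` R)"
  unfolding B_seq_def
proof (intro conjI inj_onI)
  have "code p > 0" if "p \<in> R" for p
  proof -
    have "0 < (\<Prod>i<lev p - 1. base i)" by (intro prod_pos) (simp add: base_pos)
    then show ?thesis using code_bounds(1)[OF that] by linarith
  qed
  then show "0 \<notin> code ` R" by (metis imageE less_irrefl)
next
  fix xs ys
  assume xs: "xs \<in> {xs. length xs = h \<and> sorted xs \<and> set xs \<subseteq> code ` R}"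
    and ys: "ys \<in> {xs. length xs = h \<and> sorted xs \<and> set xs \<subseteq> code ` R}"
    and eq: "sum_list xs = sum_list ys"
  define g where "g = inv_into R code"
  have cg: "code (g x) = x" "g x \<in> R" if "x \<in> code ` R" for x
    using that by (auto simp: g_def f_inv_into_f inv_into_into)
  have code_g: "image_mset code (image_mset g (mset zs)) = mset zs" if "set zs \<subseteq> code ` R" for zs
    using that by (induction zs) (auto simp: cg)
  have g_R: "set_mset (image_mset g (mset zs)) \<subseteq> R" if "set zs \<subseteq> code ` R" for zs
    using that cg(2) by fastforce
  have "image_mset g (mset xs) = image_mset g (mset ys)"
  proof (rule mset_eq_if_sum_code_eq)
    show "set_mset (image_mset g (mset xs)) \<subseteq> R" "set_mset (image_mset g (mset ys)) \<subseteq> R"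
      using xs ys by (intro g_R; simp)+
    show "(\<Sum>p\<in>#image_mset g (mset xs). code p) = (\<Sum>p\<in>#image_mset g (mset ys). code p)"
      using code_g[of xs] code_g[of ys] xs ys eq by (simp only: mem_Collect_eq sum_mset_sum_list)
  qed (use xs ys in simp_all)
  moreover have "set xs \<subseteq> code ` R" "set ys \<subseteq> code ` R" using xs ys by simp_all
  ultimately have "mset xs = mset ys" by (metis code_g)
  then show "xs = ys" using xs ys by (metis (mono_tags, lifting) mem_Collect_eq properties_for_sort sorted_sort_id)
qed

text \<open>Each bad pair removes at most one prime, and \<open>good\<close> limits the pairs to
  half of the level.\<close>

lemma card_R_level:
  assumes "k0 \<le> K"
  shows "card (P K) \<le> 2 * card (R \<inter> P K)"
proof -
  have "P K \<subseteq> (R \<inter> P K) \<union> (hd \<circ> fst) ` bad q K"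
    using assms by (auto simp: P_def R_def)
  moreover have fin: "finite (bad q K)"
    using bad_subset_cand[OF q] cand_finite_card(1) by (rule finite_subset)
  ultimately have "card (P K) \<le> card ((R \<inter> P K) \<union> (hd \<circ> fst) ` bad q K)"
    using finite_P by (intro card_mono) auto
  also have "\<dots> \<le> card (R \<inter> P K) + card ((hd \<circ> fst) ` bad q K)" by (rule card_Un_le)
  also have "\<dots> \<le> card (R \<inter> P K) + card (bad q K)" using fin by (intro add_left_mono card_image_le)
  finally show ?thesis using good[OF assms] by simp
qed

lemma prod_base_mono: "k \<le> l \<Longrightarrow> (\<Prod>i<k. base i) \<le> (\<Prod>i<l. base i)"
  using base_pos by (intro dvd_imp_le prod_dvd_prod_subset prod_pos) auto

text \<open>For such \<open>x\<close> every code of level \<open>K\<close> is counted, while a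
  counted code has level at most \<open>Suc K\<close> by the lower bound in
  \<open>code_bounds\<close>.\<close>

lemma counting_code_bounds:
  assumes "k0 \<le> K" "real (\<Prod>i<K. base i) \<le> x" "x < real (\<Prod>i<Suc K. base i)"
  shows "card (P K) \<le> 2 * counting (code ` R) x" "counting (code ` R) x \<le> 2 ^ e (Suc K)"
proof -
  define C where "C = {a \<in> code ` R. real a \<le> x}"
  have sub: "C \<subseteq> code ` {1..2 ^ e (Suc K)}"
  proof
    fix a assume "a \<in> C"
    then obtain p where p: "p \<in> R" "a = code p" "real (code p) \<le> x" by (auto simp: C_def)
    have "real (\<Prod>i<lev p - 1. base i) < real (\<Prod>i<Suc K. base i)"
      using code_bounds(1)[OF p(1)] p(3) assms(3) by linarith
    then have "lev p - 1 < Suc K" using prod_base_mono[of "Suc K" "lev p - 1"] by (meson not_le of_nat_less_iff)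
    then have "p \<le> 2 ^ e (Suc K)" by (simp flip: lev_le_iff)
    then show "a \<in> code ` {1..2 ^ e (Suc K)}"
      using p by (auto simp: R_def Suc_le_eq prime_gt_0_nat)
  qed
  then have "card C \<le> card {1::nat..2 ^ e (Suc K)}" by (rule surj_card_le[rotated]) simp
  then show "counting (code ` R) x \<le> 2 ^ e (Suc K)" by (simp add: counting_def C_def)
  have "code ` (R \<inter> P K) \<subseteq> C"
  proof
    fix a assume "a \<in> code ` (R \<inter> P K)"
    then obtain p where p: "p \<in> R" "lev p = K" "a = code p" by (auto simp: P_def)
    then show "a \<in> C" using code_bounds(2)[of p] assms(2) by (auto simp: C_def simp del: of_nat_prod)
  qed
  then have "card (code ` (R \<inter> P K)) \<le> card C"
    using sub by (intro card_mono) (auto intro: finite_subset)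
  moreover have "card (code ` (R \<inter> P K)) = card (R \<inter> P K)"
    using inj_on_code by (intro card_image) (auto intro: inj_on_subset)
  ultimately show "card (P K) \<le> 2 * counting (code ` R) x"
    using card_R_level[OF assms(1)] by (simp add: counting_def C_def)
qed

end

section \<open>Growth of the counting function\<close>

text \<open>Interpolation between the sparse points \<open>W k\<close>: each large \<open>x\<close>
  lies in one interval with large \<open>k\<close>, and measuring the lower bound at its right end
  and the upper bound at its left end makes both valid for \<open>ln x\<close>.\<close>

lemma tendsto_ln_ratio_between:
  fixes W lo hi :: "nat \<Rightarrow> real" and N :: "real \<Rightarrow> real"
  assumes "c > 0" and W: "filterlim W at_top sequentially" "mono W"
    and lo: "lo \<longlonglongrightarrow> c" and hi: "hi \<longlonglongrightarrow> c"
    and bounds: "\<forall>\<^sub>F k in sequentially. \<forall>x. W k \<le> x \<longrightarrow> x < W (Suc k) \<longrightarrow>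
      lo k * ln (W (Suc k)) \<le> ln (N x) \<and> ln (N x) \<le> hi k * ln (W k)"
  shows "((\<lambda>x. ln (N x) / ln x) \<longlongrightarrow> c) at_top"
proof -
  have ev: "\<forall>\<^sub>F x in at_top. \<exists>k. W k \<le> x \<and> x < W (Suc k) \<and> W k > 1 \<and> Q k"
    if Q: "eventually Q sequentially" for Q
  proof -
    have "\<forall>\<^sub>F k in sequentially. W k > 1" using W(1) by (simp add: filterlim_at_top_dense)
    with Q have "\<forall>\<^sub>F k in sequentially. W k > 1 \<and> Q k" by eventually_elim simp
    then obtain k1 where k1: "\<And>k. k \<ge> k1 \<Longrightarrow> W k > 1 \<and> Q k"
      by (auto simp: eventually_sequentially)
    show ?thesis
      using eventually_ge_at_top[of "W k1"]
    proof eventually_elim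
      case (elim x)
      have "\<exists>n. x < W n"
        using W(1) by (auto simp: filterlim_at_top_dense eventually_sequentially)
      then have n: "x < W (LEAST n. x < W n)" by (rule LeastI_ex)
      obtain k where k: "(LEAST n. x < W n) = Suc k"
      proof (cases "LEAST n. x < W n")
        case 0
        then have "x < W k1" using n W(2) by (auto simp: mono_def intro: less_le_trans)
        then show thesis using elim by simp
      qed (use that in blast)
      have "W k \<le> x" using not_less_Least[of k "\<lambda>n. x < W n"] k by simp
      moreover have "k1 \<le> k"
      proof (rule ccontr)
        assume "\<not> k1 \<le> k"
        then have "W (Suc k) \<le> W k1" using W(2) by (auto simp: mono_def)
        then show False using n k elim by simp
      qed
      ultimately show ?case using k1[of k] n k by auto
    qed
  qed
  show ?thesis
  proof (rule order_tendstoI)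
    fix a assume "a < c"
    \<comment> \<open>A nonnegative threshold makes \<open>lo k\<close> positive, so multiplying by
      it preserves inequalities.\<close>
    define a' where "a' = max a 0"
    have "a' < c" "a \<le> a'" "0 \<le> a'" using \<open>a < c\<close> \<open>c > 0\<close> by (auto simp: a'_def)
    have "\<forall>\<^sub>F k in sequentially. a' < lo k \<and> (\<forall>x. W k \<le> x \<longrightarrow> x < W (Suc k) \<longrightarrow>
        lo k * ln (W (Suc k)) \<le> ln (N x))"
      using order_tendstoD(1)[OF lo \<open>a' < c\<close>] bounds by eventually_elim blast
    from ev[OF this] show "\<forall>\<^sub>F x in at_top. a < ln (N x) / ln x"
    proof eventually_elim
      case (elim x)
      then obtain k where k: "W k \<le> x" "x < W (Suc k)" "W k > 1" "a' < lo k"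
        "lo k * ln (W (Suc k)) \<le> ln (N x)" by blast
      have lx: "0 < ln x" using k by simp
      have "ln x \<le> ln (W (Suc k))" using k by simp
      have "a' * ln x < lo k * ln x" using k lx by simp
      also have "\<dots> \<le> lo k * ln (W (Suc k))"
        using \<open>ln x \<le> _\<close> k \<open>0 \<le> a'\<close> by (intro mult_left_mono) auto
      also have "\<dots> \<le> ln (N x)" by fact
      finally have "a' < ln (N x) / ln x" using lx by (simp add: field_simps)
      then show ?case using \<open>a \<le> a'\<close> by simp
    qed
  next
    fix a assume "c < a"
    have "\<forall>\<^sub>F k in sequentially. hi k < a \<and> (\<forall>x. W k \<le> x \<longrightarrow> x < W (Suc k) \<longrightarrow>
        ln (N x) \<le> hi k * ln (W k))"
      using order_tendstoD(2)[OF hi \<open>c < a\<close>] bounds by eventually_elim blast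
    from ev[OF this] show "\<forall>\<^sub>F x in at_top. ln (N x) / ln x < a"
    proof eventually_elim
      case (elim x)
      then obtain k where k: "W k \<le> x" "x < W (Suc k)" "W k > 1" "hi k < a"
        "ln (N x) \<le> hi k * ln (W k)" by blast
      have lx: "0 < ln (W k)" "ln (W k) \<le> ln x" using k by auto
      have "ln (N x) \<le> hi k * ln (W k)" by fact
      also have "\<dots> < a * ln (W k)" using k lx by simp
      also have "\<dots> \<le> a * ln x" using lx \<open>c < a\<close> \<open>c > 0\<close> by (intro mult_left_mono) auto
      finally show ?case using lx by (simp add: field_simps)
    qed
  qed
qed

lemma (in bh_coding) ln_prod_base:
  "ln (real (\<Prod>i<k. base i)) = real k * ln (real (h * (h + 1))) + ((real k + 1) ^ 3 - 1) * ln 2"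
proof (induction k)
  case (Suc k)
  have "ln (real (\<Prod>i<Suc k. base i)) = ln (real (\<Prod>i<k. base i)) + ln (real (base k))"
    using base_pos by (simp add: ln_mult prod_pos del: of_nat_prod)
  also have "ln (real (base k)) = ln (real (h * (h + 1))) + real (dig (Suc k)) * ln 2"
  proof -
    have "real (base k) = real (h * (h + 1)) * 2 ^ dig (Suc k)" by (simp add: base_def)
    moreover have "real (h * (h + 1)) > 0" unfolding of_nat_0_less_iff using h by simp
    ultimately show ?thesis by (simp only: ln_mult_pos zero_less_power zero_less_numeral ln_realpow)
  qed
  also have "real (dig (Suc k)) = (real (Suc k) + 1) ^ 3 - (real k + 1) ^ 3"
    by (simp add: dig_def power2_eq_square power3_eq_cube algebra_simps)
  finally show ?case using Suc by (simp add: algebra_simps)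
qed simp

lemma (in bh_coding) infinite_code: "infinite (code ` R)"
proof
  assume "finite (code ` R)"
  then have "finite R" using inj_on_code by (rule finite_imageD)
  moreover have "{k0..} \<subseteq> lev ` R"
  proof
    fix K assume "K \<in> {k0..}"
    then have "card (R \<inter> P K) > 0" using card_R_level[of K] card_P_pos[of K] by simp
    then show "K \<in> lev ` R" by (auto simp: card_gt_0_iff P_def)
  qed
  ultimately show False using infinite_Ici[of k0] by (meson finite_imageI finite_subset)
qed

lemma (in bh_coding) tendsto_ln_counting:
  assumes e_ge: "\<And>k. c * (real k ^ 3 - real k ^ 2) - 1 \<le> real (e k)"
    and card: "\<And>k. k0 \<le> k \<Longrightarrow> 2 ^ e k \<le> 2 * real k ^ 3 * real (card (P k))"
  shows "((\<lambda>x. ln (real (counting (code ` R) x)) / ln x) \<longlongrightarrow> c) at_top"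
proof -
  define W where "W = (\<lambda>k. real (\<Prod>i<k. base i))"
  define L where "L = ln (real (h * (h + 1)))"
  \<comment> \<open>The numerators of \<open>lo\<close> and \<open>hi\<close> bound the logarithm of
    the count through levels \<open>k\<close> and \<open>Suc k\<close>; the denominators are
    \<open>ln (W (Suc k))\<close> and \<open>ln (W k)\<close>. All are of order
    \<open>k ^ 3\<close>, so shifting the level by one does not affect the limit.\<close>
  define lo where "lo = (\<lambda>k. ((c * (real k ^ 3 - real k ^ 2) - 1) * ln 2 - ln (4 * real k ^ 3)) /
     (real (Suc k) * L + ((real (Suc k) + 1) ^ 3 - 1) * ln 2))"
  define hi where "hi = (\<lambda>k. (c * (real (Suc k) ^ 3 - real (Suc k) ^ 2) * ln 2) /
     (real k * L + ((real k + 1) ^ 3 - 1) * ln 2))"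
  have lnW: "ln (W k) = real k * L + ((real k + 1) ^ 3 - 1) * ln 2" for k
    unfolding W_def L_def by (rule ln_prod_base)
  have Wpos: "W k > 0" for k unfolding W_def using base_pos by (simp add: prod_pos del: of_nat_prod)
  have Wge: "real k \<le> W k" for k
  proof -
    have "k \<le> (\<Prod>i<k. base i)"
    proof (induction k)
      case (Suc k)
      have "2 * (\<Prod>i<k. base i) \<le> base k * (\<Prod>i<k. base i)"
      proof -
        have "1 * 2 * 1 \<le> base k" unfolding base_def using h by (intro mult_le_mono) auto
        then show ?thesis by simp
      qed
      moreover have "0 < (\<Prod>i<k. base i)" using base_pos by (simp add: prod_pos)
      ultimately have "Suc k \<le> base k * (\<Prod>i<k. base i)" using Suc by linarith
      then show ?case by (simp add: mult.commute)
    qed simp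
    then show ?thesis unfolding W_def of_nat_le_iff .
  qed
  have "filterlim W at_top sequentially"
    by (rule filterlim_at_top_mono[OF filterlim_real_sequentially]) (simp add: Wge)
  moreover have "mono W" unfolding W_def by (intro monoI of_nat_mono prod_base_mono)
  moreover have "lo \<longlonglongrightarrow> c" unfolding lo_def by real_asymp
  moreover have "hi \<longlonglongrightarrow> c" unfolding hi_def by real_asymp
  moreover have "\<forall>\<^sub>F k in sequentially. \<forall>x. W k \<le> x \<longrightarrow> x < W (Suc k) \<longrightarrow>
      lo k * ln (W (Suc k)) \<le> ln (real (counting (code ` R) x)) \<and>
      ln (real (counting (code ` R) x)) \<le> hi k * ln (W k)"
    using eventually_ge_at_top[of k0]
  proof (eventually_elim, intro allI impI)
    fix k x assume k: "k0 \<le> k" and x: "W k \<le> x" "x < W (Suc k)"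
    define N where "N = counting (code ` R) x"
    have k1: "k \<ge> 1" using k k0 by simp
    have "1 * 2 \<le> h * (h + 1)" using h by (intro mult_le_mono) auto
    then have "real 1 < real (h * (h + 1))" unfolding of_nat_less_iff by simp
    then have Lpos: "L > 0" unfolding L_def by (intro ln_gt_zero) (simp only: of_nat_1)
    have lnWpos: "ln (W j) > 0" if "j \<ge> 1" for j
    proof -
      have "1 < (real j + 1) ^ 3" using that by (intro one_less_power) auto
      then show ?thesis unfolding lnW using Lpos by (intro add_nonneg_pos mult_nonneg_nonneg mult_pos_pos) auto
    qed
    have N: "card (P k) \<le> 2 * N" "N \<le> 2 ^ e (Suc k)"
      unfolding N_def using counting_code_bounds[OF k] x by (auto simp: W_def)
    have Npos: "real N > 0" using N(1) card_P_pos[OF k] by simp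
    have "2 ^ e k \<le> 2 * real k ^ 3 * real (card (P k))" by (rule card[OF k])
    also have "\<dots> \<le> 2 * real k ^ 3 * (2 * real N)"
      using N(1) by (intro mult_left_mono) auto
    finally have "2 ^ e k \<le> 4 * real k ^ 3 * real N" by simp
    then have "ln (2 ^ e k) \<le> ln (4 * real k ^ 3 * real N)"
      using Npos k1 by (subst ln_le_cancel_iff) auto
    also have "\<dots> = ln (4 * real k ^ 3) + ln (real N)"
      using Npos k1 by (intro ln_mult_pos) auto
    finally have "real (e k) * ln 2 \<le> ln (4 * real k ^ 3) + ln (real N)"
      by (simp add: ln_realpow)
    moreover have "(c * (real k ^ 3 - real k ^ 2) - 1) * ln 2 \<le> real (e k) * ln 2"
      using e_ge[of k] by (intro mult_right_mono) auto
    ultimately have "(c * (real k ^ 3 - real k ^ 2) - 1) * ln 2 - ln (4 * real k ^ 3) \<le> ln (real N)"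
      by linarith
    then have "lo k * ln (W (Suc k)) \<le> ln (real N)"
      using lnWpos[of "Suc k"] unfolding lo_def lnW by simp
    moreover have "ln (real N) \<le> ln (2 ^ e (Suc k))"
      using N(2) Npos by (subst ln_le_cancel_iff) (auto simp: of_nat_le_iff[symmetric] simp del: of_nat_le_iff)
    then have "ln (real N) \<le> real (e (Suc k)) * ln 2" by (simp add: ln_realpow)
    then have "ln (real N) \<le> c * (real (Suc k) ^ 3 - real (Suc k) ^ 2) * ln 2"
      by (rule order_trans) (intro mult_right_mono e_le, simp)
    then have "ln (real N) \<le> hi k * ln (W k)"
      using lnWpos[OF k1] unfolding hi_def lnW by simp
    ultimately show "lo k * ln (W (Suc k)) \<le> ln (real (counting (code ` R) x)) \<and>
      ln (real (counting (code ` R) x)) \<le> hi k * ln (W k)" by (simp add: N_def)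
  qed
  ultimately show ?thesis using c(1) by (intro tendsto_ln_ratio_between[of c W lo hi])
qed

section \<open>Choice of the parameters\<close>

lemma ex_bh_construction:
  fixes h :: nat
  assumes h: "h \<ge> 2"
  defines "c \<equiv> sqrt ((real h - 1)\<^sup>2 + 1) - (real h - 1)"
  defines "e \<equiv> \<lambda>k. nat \<lfloor>c * (real k ^ 3 - real k ^ 2)\<rfloor>"
  shows "\<exists>k0. bh_construction h e k0 c \<and> (\<forall>k\<ge>k0. 2 ^ e k \<le>
    2 * real k ^ 3 * real (card {p::nat. prime p \<and> 2 ^ e (k - 1) < p \<and> p \<le> 2 ^ e k}))"
proof -
  define H where "H = real h"
  have H: "H \<ge> 2" using h by (simp add: H_def)
  define s where "s = sqrt ((H - 1)\<^sup>2 + 1)"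
  have cs: "c = s - (H - 1)" by (simp add: c_def s_def H_def)
  have s2: "s\<^sup>2 = (H - 1)\<^sup>2 + 1" by (simp add: s_def)
  have c0: "c > 0"
  proof -
    have "H - 1 < s" unfolding s_def by (rule real_less_rsqrt) simp
    then show ?thesis by (simp add: cs)
  qed
  have cq: "c\<^sup>2 + 2 * (H - 1) * c = 1"
    using s2 by (simp add: cs power2_eq_square algebra_simps)
  have c1: "c < 1"
  proof (rule ccontr)
    assume "\<not> c < 1"
    then have "1 * 1 \<le> c * c" "2 * 1 * 1 \<le> 2 * (H - 1) * c" using H by (intro mult_mono; simp)+
    then show False using cq by (simp add: power2_eq_square)
  qed
  have nn: "0 \<le> c * (real k ^ 3 - real k ^ 2)" for k
    using c0 power_increasing[of 2 3 "real k"] by (cases "k = 0") (auto intro: mult_nonneg_nonneg)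
  have e_le: "real (e k) \<le> c * (real k ^ 3 - real k ^ 2)" for k
    using nn[of k] by (simp add: e_def)
  have e_ge: "c * (real k ^ 3 - real k ^ 2) - 1 \<le> real (e k)" for k
    unfolding e_def by linarith
  have e_cube: "real (e k) \<le> real k ^ 3" for k
  proof -
    have "c * (real k ^ 3 - real k ^ 2) \<le> 1 * (real k ^ 3 - real k ^ 2)"
      using c1 nn[of k] c0 by (intro mult_right_mono) (auto simp: zero_le_mult_iff)
    also have "\<dots> \<le> real k ^ 3" by simp
    finally show ?thesis using e_le[of k] by (rule order_trans[rotated])
  qed
  have "mono e"
  proof (rule incseq_SucI)
    fix k
    have "real k ^ 3 - real k ^ 2 \<le> real (Suc k) ^ 3 - real (Suc k) ^ 2"
      by (simp add: power2_eq_square power3_eq_cube algebra_simps)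
    then show "e k \<le> e (Suc k)"
      unfolding e_def using c0 by (intro nat_mono floor_mono mult_left_mono) auto
  qed
  \<comment> \<open>Yields \<open>dig k <= e (k - 1)\<close>; the final \<open>- 1\<close> pays for
    the floor in \<open>e\<close>.\<close>
  have "\<forall>\<^sub>F k in sequentially. 3 * real k ^ 2 + 3 * real k + 1 \<le>
      c * ((real k - 1) ^ 3 - (real k - 1) ^ 2) - 1"
    using c0 by real_asymp
  \<comment> \<open>Discarding the primes up to \<open>2 ^ e (k - 1)\<close> costs at most half of
    the main term, since the exponents of consecutive levels differ by order
    \<open>k ^ 2\<close>.\<close>
  moreover have "\<forall>\<^sub>F k in sequentially.
      1 + real k ^ 3 * 2 powr (c * ((real k - 1) ^ 3 - (real k - 1) ^ 2))
      \<le> 2 powr (c * (real k ^ 3 - real k ^ 2) - 1) / 2"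
    using c0 by real_asymp
  \<comment> \<open>Yields \<open>many\<close>: the left side is two to the power of order
    \<open>k * ln k\<close>. Its factor \<open>2 * real k ^ 3\<close> comes from the lower bound for
    the number of primes of a level.\<close>
  moreover have "\<forall>\<^sub>F k in sequentially.
      2 * real k ^ 3 * ((H + 1) * (real k + 1) powr H * (H * real k ^ 3) powr real k * 2 powr (real k + 2))
      \<le> 2 powr (real k ^ 2)"
    using H by real_asymp
  ultimately have "\<forall>\<^sub>F k in sequentially. k \<ge> 1 \<and>
      3 * real k ^ 2 + 3 * real k + 1 \<le> c * ((real k - 1) ^ 3 - (real k - 1) ^ 2) - 1 \<and>
      1 + real k ^ 3 * 2 powr (c * ((real k - 1) ^ 3 - (real k - 1) ^ 2))
      \<le> 2 powr (c * (real k ^ 3 - real k ^ 2) - 1) / 2 \<and>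
      2 * real k ^ 3 * ((H + 1) * (real k + 1) powr H * (H * real k ^ 3) powr real k * 2 powr (real k + 2))
      \<le> 2 powr (real k ^ 2)"
    using eventually_ge_at_top[of 1] by eventually_elim simp
  then obtain k0 where k0: "\<And>k. k \<ge> k0 \<Longrightarrow> k \<ge> 1 \<and>
      3 * real k ^ 2 + 3 * real k + 1 \<le> c * ((real k - 1) ^ 3 - (real k - 1) ^ 2) - 1 \<and>
      1 + real k ^ 3 * 2 powr (c * ((real k - 1) ^ 3 - (real k - 1) ^ 2))
      \<le> 2 powr (c * (real k ^ 3 - real k ^ 2) - 1) / 2 \<and>
      2 * real k ^ 3 * ((H + 1) * (real k + 1) powr H * (H * real k ^ 3) powr real k * 2 powr (real k + 2))
      \<le> 2 powr (real k ^ 2)"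
    by (auto simp: eventually_sequentially)
  have dig_e: "dig k \<le> e (k - 1)" if "k \<ge> k0" for k
  proof -
    have "real (dig k) \<le> c * ((real k - 1) ^ 3 - (real k - 1) ^ 2) - 1"
      using k0[OF that] by (simp add: dig_def)
    also have "\<dots> \<le> real (e (k - 1))" using e_ge[of "k - 1"] k0[OF that] by (simp add: of_nat_diff)
    finally show ?thesis by simp
  qed
  have card: "2 ^ e k \<le> 2 * real k ^ 3 *
      real (card {p::nat. prime p \<and> 2 ^ e (k - 1) < p \<and> p \<le> 2 ^ e k})" if "k \<ge> k0" for k
  proof -
    define n where "n = card {p::nat. prime p \<and> 2 ^ e (k - 1) < p \<and> p \<le> 2 ^ e k}"
    have k: "k \<ge> 1" using k0[OF that] by simp
    have "e k \<ge> 1"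
      using dig_e[OF that] \<open>mono e\<close> monoD[of e "k - 1" k] by (simp add: dig_def)
    then have "2 ^ e k \<le> e k * card {p::nat. prime p \<and> p \<le> 2 ^ e k} + 1"
      by (rule card_primes_le_power_two)
    also have "\<dots> \<le> e k * (n + 2 ^ e (k - 1)) + 1"
      unfolding n_def by (intro add_right_mono mult_le_mono2 card_primes_Ioc_ge)
    finally have "real (2 ^ e k) \<le> real (e k * (n + 2 ^ e (k - 1)) + 1)"
      by (simp only: of_nat_le_iff)
    then have "2 ^ e k \<le> real (e k) * (real n + 2 ^ e (k - 1)) + 1" by simp
    also have "\<dots> \<le> real k ^ 3 * (real n + 2 ^ e (k - 1)) + 1"
      using e_cube[of k] by (intro add_right_mono mult_right_mono) auto
    also have "\<dots> = real k ^ 3 * real n + (1 + real k ^ 3 * 2 ^ e (k - 1))"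
      by (simp add: algebra_simps)
    also have "1 + real k ^ 3 * 2 ^ e (k - 1) \<le> 2 ^ e k / 2"
    proof -
      have "(2::real) ^ e (k - 1) = 2 powr real (e (k - 1))" by (simp add: powr_realpow)
      also have "\<dots> \<le> 2 powr (c * ((real k - 1) ^ 3 - (real k - 1) ^ 2))"
        using e_le[of "k - 1"] k by (intro powr_mono) (auto simp: of_nat_diff)
      finally have "1 + real k ^ 3 * 2 ^ e (k - 1) \<le>
          1 + real k ^ 3 * 2 powr (c * ((real k - 1) ^ 3 - (real k - 1) ^ 2))"
        by (intro add_left_mono mult_left_mono) auto
      also have "\<dots> \<le> 2 powr (c * (real k ^ 3 - real k ^ 2) - 1) / 2" using k0[OF that] by blast
      also have "\<dots> \<le> 2 powr real (e k) / 2"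
        using e_ge[of k] by (intro divide_right_mono powr_mono) auto
      finally show ?thesis by (simp add: powr_realpow)
    qed
    finally show ?thesis by (simp add: n_def)
  qed
  have many: "(real h + 1) * (real K + 1) ^ h * (real h * real (e K)) ^ K * 2 ^ (K + 2) * 2 ^ e K
      \<le> 2 ^ K\<^sup>2 * real (card {p::nat. prime p \<and> 2 ^ e (K - 1) < p \<and> p \<le> 2 ^ e K})"
    if "K \<ge> k0" for K
  proof -
    define n where "n = real (card {p::nat. prime p \<and> 2 ^ e (K - 1) < p \<and> p \<le> 2 ^ e K})"
    define C where "C = (real h + 1) * (real K + 1) ^ h * (real h * real K ^ 3) ^ K * 2 ^ (K + 2)"
    have K: "K \<ge> 1" using k0[OF that] by simp
    have "2 powr (real K + 2) = 2 ^ (K + 2)" "2 powr (real K ^ 2) = 2 ^ K\<^sup>2"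
      by (simp_all add: powr_add powr_realpow flip: of_nat_power)
    moreover have "(real K + 1) powr real h = (real K + 1) ^ h"
      "(real h * real K ^ 3) powr real K = (real h * real K ^ 3) ^ K"
      using K h by (auto intro!: powr_realpow)
    ultimately have CK: "2 * real K ^ 3 * C \<le> 2 ^ K\<^sup>2"
      using k0[OF that] by (simp add: C_def H_def)
    have "(real h + 1) * (real K + 1) ^ h * (real h * real (e K)) ^ K * 2 ^ (K + 2) \<le> C"
      unfolding C_def using e_cube[of K]
      by (intro mult_right_mono mult_left_mono power_mono) auto
    then have "(real h + 1) * (real K + 1) ^ h * (real h * real (e K)) ^ K * 2 ^ (K + 2) * 2 ^ e K
        \<le> C * (2 * real K ^ 3 * n)"
      using card[OF that] by (intro mult_mono) (auto simp: n_def C_def)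
    also have "\<dots> = (2 * real K ^ 3 * C) * n" by simp
    also have "\<dots> \<le> 2 ^ K\<^sup>2 * n" using CK by (intro mult_right_mono) (auto simp: n_def)
    finally show ?thesis by (simp add: n_def)
  qed
  have "bh_construction h e k0 c"
  proof
    show "c\<^sup>2 + 2 * (real h - 1) * c = 1" using cq by (simp add: H_def)
    show "k0 \<ge> 1" using k0[of k0] by simp
  qed (use h c0 c1 \<open>mono e\<close> dig_e e_le many in auto)
  then show ?thesis using card by blast
qed

theorem theorem3:
  fixes h :: nat
  assumes "h \<ge> 3"
  shows "\<exists>A :: nat set. infinite A \<and> B_seq h A \<and>
    (\<exists>\<epsilon> :: real \<Rightarrow> real. \<epsilon> \<in> o[at_top](\<lambda>_. 1) \<and>
      (\<forall>\<^sub>F x in at_top. real (counting A x) =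
         x powr (sqrt ((real h - 1)\<^sup>2 + 1) - (real h - 1) + \<epsilon> x)))"
proof -
  define c where "c = sqrt ((real h - 1)\<^sup>2 + 1) - (real h - 1)"
  define e where "e = (\<lambda>k. nat \<lfloor>c * (real k ^ 3 - real k ^ 2)\<rfloor>)"
  obtain k0 where constr: "bh_construction h e k0 c"
    and card: "\<And>k. k \<ge> k0 \<Longrightarrow> 2 ^ e k \<le>
      2 * real k ^ 3 * real (card {p::nat. prime p \<and> 2 ^ e (k - 1) < p \<and> p \<le> 2 ^ e k})"
    using ex_bh_construction[of h] assms unfolding c_def e_def by auto
  interpret bh_construction h e k0 c by (rule constr)
  obtain q where q: "\<And>j. q j \<in> moduli j" "\<And>j. k0 \<le> j \<Longrightarrow> 2 * card (bad q j) \<le> card (P j)"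
    using ex_good_moduli by blast
  interpret bh_coding h e k0 c q by unfold_locales (use q in auto)
  define N where "N = (\<lambda>x. real (counting (code ` R) x))"
  have lim: "((\<lambda>x. ln (N x) / ln x) \<longlongrightarrow> c) at_top"
    unfolding N_def
  proof (rule tendsto_ln_counting)
    show "c * (real k ^ 3 - real k ^ 2) - 1 \<le> real (e k)" for k
      unfolding e_def by linarith
    show "2 ^ e k \<le> 2 * real k ^ 3 * real (card (P k))" if "k0 \<le> k" for k
      using card[OF that] that k0 by (subst P_eq) auto
  qed
  have "(\<lambda>x. ln (N x) / ln x - c) \<in> o[at_top](\<lambda>_. 1)"
  proof (rule smalloI_tendsto)
    show "((\<lambda>x. (ln (N x) / ln x - c) / 1) \<longlongrightarrow> 0) at_top"
      using tendsto_diff[OF lim tendsto_const[of c]] by simp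
  qed simp
  moreover have "\<forall>\<^sub>F x in at_top. N x = x powr (c + (ln (N x) / ln x - c))"
    using order_tendstoD(1)[OF lim c(1)] eventually_gt_at_top[of 1]
  proof eventually_elim
    case (elim x)
    \<comment> \<open>As \<open>ln 0 = 0\<close>, a zero count would make the ratio 0, whereas it is
      eventually positive.\<close>
    then have "N x \<noteq> 0" by (intro notI) simp
    then have "N x > 0" by (simp add: N_def)
    then show ?case using elim by (simp add: powr_def)
  qed
  ultimately show ?thesis
    using infinite_code B_seq_code unfolding N_def c_def by (intro exI[of _ "code ` R"]) blast
qed

end
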